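(* For every infinite cardinal $\nu$ and every cardinal $\rho\ge\beth_\omega(\nu)$, every $\rho$-uniform family of sets $\mathcal F$ which satisfies $C(\rho^+,\nu)$ satisfies $\chi_{\ell CF}(\mathcal F)\le\rho^+$.
   Context: Work in ZFC. $\beth_0(\nu)=\nu$, $\beth_{n+1}(\nu)=2^{\beth_n(\nu)}$, $\beth_\omega(\nu)=\sup_{n<\omega}\beth_n(\nu)$. A family $\mathcal F$ is $\rho$-uniform if $|A|=\rho$ for all $A\in\mathcal F$. $\mathcal F$ satisfies $C(\theta,\nu)$ if $|\bigcap\mathcal A|<\nu$ for every subfamily $\mathcal A\subseteq\mathcal F$ of cardinality $\theta$. Let $V=V(\mathcal F)=\bigcup\mathcal F$. A coloring $c$ of $V$ is conflict free (for $\mathcal F$) if for every $A\in\mathcal F$ there is $x\in A$ such that $c(x)\ne c(y)$ for all $y\in A\setminus\{x\}$. The list-conflict-free number $\chi_{\ell CF}(\mathcal F)$ is the smallest cardinal $\kappa$ such that for every assignment $L$ of sets $L(v)$ to the points $v\in V$ with $|L(v)|\ge\kappa$ for all $v\in V$, there exists a conflict-free coloring $c$ of $V$ with $c(v)\in L(v)$ for all $v\in V$. *)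

theory Defs
  imports Main
begin

unbundle cardinal_syntax

text \<open>
  Cardinals are represented as in the library, by relations \<open>r\<close> with \<open>Card_order r\<close>, possibly over
  different types, compared by \<open>\<le>o\<close>, \<open><o\<close> and \<open>=o\<close>; the successor of \<open>r\<close> is \<open>cardSuc r\<close>.
\<close>

text \<open>
  No type constructor of HOL yields a type of cardinality \<open>\<beth>\<^sub>\<omega>\<close> of its argument, so the beth hierarchy
  is described by predicates: \<open>is_beth \<nu> n \<beta>\<close> says that \<open>\<beta>\<close> is a cardinal equal to \<open>\<beth>\<^sub>n(\<nu>)\<close>, and
  \<open>is_beth_omega \<nu> \<beta>\<close> that it is equal to \<open>\<beth>\<^sub>\<omega>(\<nu>)\<close>. That the auxiliary cardinals live over
  the same type as \<open>\<beta>\<close> is no restriction, since those occurring are bounded by \<open>\<beta>\<close>.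
\<close>

primrec is_beth :: "'n rel \<Rightarrow> nat \<Rightarrow> 'b rel \<Rightarrow> bool" where
  "is_beth \<nu> 0 \<beta> \<longleftrightarrow> Card_order \<beta> \<and> \<beta> =o \<nu>"
| "is_beth \<nu> (Suc n) \<beta> \<longleftrightarrow> Card_order \<beta> \<and> (\<exists>\<gamma> :: 'b rel. is_beth \<nu> n \<gamma> \<and> \<beta> =o ctwo ^c \<gamma>)"

definition is_beth_omega :: "'n rel \<Rightarrow> 'b rel \<Rightarrow> bool" where
  "is_beth_omega \<nu> \<beta> \<longleftrightarrow> Card_order \<beta>
     \<and> (\<forall>n. \<exists>\<gamma> :: 'b rel. is_beth \<nu> n \<gamma> \<and> \<gamma> \<le>o \<beta>)
     \<and> (\<forall>\<delta> :: 'b rel. Card_order \<delta> \<and> (\<forall>n (\<gamma> :: 'b rel). is_beth \<nu> n \<gamma> \<longrightarrow> \<gamma> \<le>o \<delta>) \<longrightarrow> \<beta> \<le>o \<delta>)"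

definition uniform_family :: "'r rel \<Rightarrow> 'a set set \<Rightarrow> bool" where
  "uniform_family \<rho> \<F> \<longleftrightarrow> (\<forall>A\<in>\<F>. |A| =o \<rho>)"

definition C_condition :: "'t rel \<Rightarrow> 'n rel \<Rightarrow> 'a set set \<Rightarrow> bool" where
  "C_condition \<theta> \<nu> \<F> \<longleftrightarrow> (\<forall>\<A> \<subseteq> \<F>. |\<A>| =o \<theta> \<longrightarrow> |\<Inter>\<A>| <o \<nu>)"

text \<open>Only the values of \<open>c\<close> on \<open>\<Union>\<F>\<close> matter, so colorings are total functions.\<close>

definition conflict_free :: "'a set set \<Rightarrow> ('a \<Rightarrow> 'c) \<Rightarrow> bool" where
  "conflict_free \<F> c \<longleftrightarrow> (\<forall>A\<in>\<F>. \<exists>x\<in>A. \<forall>y\<in>A - {x}. c x \<noteq> c y)"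

definition list_conflict_free :: "'c itself \<Rightarrow> 'a set set \<Rightarrow> 'k rel \<Rightarrow> bool" where
  "list_conflict_free TYPE('c) \<F> \<kappa> \<longleftrightarrow>
     (\<forall>L :: 'a \<Rightarrow> 'c set. (\<forall>v\<in>\<Union>\<F>. \<kappa> \<le>o |L v| ) \<longrightarrow>
        (\<exists>c. conflict_free \<F> c \<and> (\<forall>v\<in>\<Union>\<F>. c v \<in> L v)))"

text \<open>
  The list-conflict-free number, with the colors in the lists taken from the type \<open>'c\<close>. If no member
  of \<open>\<F>\<close> is empty, then the least cardinal exists and is at most the cardinality of \<open>\<Union>\<F>\<close>, so
  it can be sought over the type \<open>'a\<close> (\<open>list_cf_number\<close> and \<open>list_cf_number_least\<close> below).
  An undersized color type could only make the number smaller; all infinite color types at least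
  as large as \<open>'a\<close> give the same number (\<open>list_cf_number_color_type\<close>).
\<close>

definition list_cf_number :: "'c itself \<Rightarrow> 'a set set \<Rightarrow> 'a rel" where
  "list_cf_number TYPE('c) \<F> = (SOME \<kappa> :: 'a rel.
     Card_order \<kappa> \<and> list_conflict_free TYPE('c) \<F> \<kappa> \<and>
     (\<forall>\<kappa>' :: 'a rel. Card_order \<kappa>' \<and> list_conflict_free TYPE('c) \<F> \<kappa>' \<longrightarrow> \<kappa> \<le>o \<kappa>'))"

lemma Card_order_subset:
  assumes "Card_order \<kappa>" and "\<kappa> \<le>o |A|"
  shows "\<exists>B. B \<subseteq> A \<and> |B| =o \<kappa>"
proof -
  have fld: "|Field \<kappa>| =o \<kappa>" using assms(1) by (rule card_of_Field_ordIso)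
  hence "|Field \<kappa>| \<le>o |A|" using assms(2) by (rule ordIso_ordLeq_trans)
  then obtain B where B: "B \<subseteq> A" "|Field \<kappa>| =o |B|"
    using internalize_card_of_ordLeq2[of "Field \<kappa>" A] by blast
  from ordIso_transitive[OF ordIso_symmetric[OF B(2)] fld] B(1) show ?thesis by blast
qed

lemma list_conflict_free_mono:
  fixes \<F> :: "'a set set"
  assumes "list_conflict_free TYPE('c) \<F> \<kappa>" and "\<kappa> \<le>o \<kappa>'"
  shows "list_conflict_free TYPE('c) \<F> \<kappa>'"
  unfolding list_conflict_free_def
proof (intro allI impI)
  fix L :: "'a \<Rightarrow> 'c set"
  assume "\<forall>v\<in>\<Union>\<F>. \<kappa>' \<le>o |L v|"
  hence "\<forall>v\<in>\<Union>\<F>. \<kappa> \<le>o |L v|" using ordLeq_transitive[OF assms(2)] by blast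
  thus "\<exists>c. conflict_free \<F> c \<and> (\<forall>v\<in>\<Union>\<F>. c v \<in> L v)"
    using assms(1) unfolding list_conflict_free_def by blast
qed

lemma injective_choice:
  fixes L :: "'a \<Rightarrow> 'c set"
  assumes L: "\<And>v. v \<in> V \<Longrightarrow> |V| \<le>o |L v|"
  shows "\<exists>c. inj_on c V \<and> (\<forall>v\<in>V. c v \<in> L v)"
proof -
  define r where "r = |V|"
  have wo: "Well_order r" and fld: "Field r = V" and co: "Card_order r"
    unfolding r_def by (rule card_of_Well_order Field_card_of card_of_Card_order)+
  have wf: "wf (r - Id)" using wo by (simp add: well_order_on_def)
  define c where "c = wfrec (r - Id) (\<lambda>f v. SOME x. x \<in> L v \<and> x \<notin> f ` underS r v)"
  have rec: "c v = (SOME x. x \<in> L v \<and> x \<notin> c ` underS r v)" for v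
  proof -
    have "cut c (r - Id) v ` underS r v = c ` underS r v"
      by (intro image_cong) (auto simp: cut_def underS_def)
    thus ?thesis unfolding c_def by (subst wfrec[OF wf]) (simp add: c_def)
  qed
  have c: "c v \<in> L v \<and> c v \<notin> c ` underS r v" if v: "v \<in> V" for v
  proof -
    have "|underS r v| <o r" using card_of_underS[OF co] v fld by simp
    hence "|c ` underS r v| <o r" by (rule ordLeq_ordLess_trans[OF card_of_image])
    hence "|c ` underS r v| <o |L v|"
      using ordLess_ordLeq_trans L[OF v] unfolding r_def by blast
    hence "\<not> L v \<subseteq> c ` underS r v"
      using card_of_mono1 not_ordLess_ordLeq by blast
    hence "\<exists>x. x \<in> L v \<and> x \<notin> c ` underS r v" by blast
    thus ?thesis unfolding rec[of v] by (rule someI_ex)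
  qed
  have "inj_on c V"
  proof (rule inj_onI, rule ccontr)
    fix u v assume uv: "u \<in> V" "v \<in> V" "c u = c v" "u \<noteq> v"
    have "(u, v) \<in> r \<or> (v, u) \<in> r"
      using wo uv fld unfolding well_order_on_def linear_order_on_def total_on_def by blast
    hence "u \<in> underS r v \<or> v \<in> underS r u" using uv by (auto simp: underS_def)
    thus False using c uv by (metis imageI)
  qed
  with c show ?thesis by blast
qed

lemma list_conflict_free_card:
  assumes "{} \<notin> \<F>"
  shows "list_conflict_free TYPE('c) \<F> |\<Union>\<F>|"
  unfolding list_conflict_free_def
proof (intro allI impI)
  fix L :: "'a \<Rightarrow> 'c set"
  assume "\<forall>v\<in>\<Union>\<F>. |\<Union>\<F>| \<le>o |L v|"
  then obtain c where c: "inj_on c (\<Union>\<F>)" "\<forall>v\<in>\<Union>\<F>. c v \<in> L v"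
    using injective_choice[of "\<Union>\<F>" L] by blast
  have "\<exists>x\<in>A. \<forall>y\<in>A - {x}. c x \<noteq> c y" if A: "A \<in> \<F>" for A
  proof -
    obtain x where x: "x \<in> A" using A assms by (metis equals0I)
    have "c x \<noteq> c y" if "y \<in> A - {x}" for y
      using inj_onD[OF c(1), of x y] x A that by blast
    with x show ?thesis by blast
  qed
  with c(2) show "\<exists>c. conflict_free \<F> c \<and> (\<forall>v\<in>\<Union>\<F>. c v \<in> L v)"
    unfolding conflict_free_def by blast
qed

lemma list_cf_number:
  fixes \<F> :: "'a set set"
  assumes "{} \<notin> \<F>"
  shows "Card_order (list_cf_number TYPE('c) \<F>)"
    and "list_conflict_free TYPE('c) \<F> (list_cf_number TYPE('c) \<F>)"
    and "\<And>\<kappa> :: 'a rel. Card_order \<kappa> \<Longrightarrow> list_conflict_free TYPE('c) \<F> \<kappa> \<Longrightarrow>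
           list_cf_number TYPE('c) \<F> \<le>o \<kappa>"
proof -
  let ?R = "{\<kappa> :: 'a rel. Card_order \<kappa> \<and> list_conflict_free TYPE('c) \<F> \<kappa>}"
  have "?R \<noteq> {}" using list_conflict_free_card[OF assms] card_of_Card_order by blast
  moreover have "\<forall>r\<in>?R. Card_order r" by blast
  ultimately have "\<exists>r\<in>?R. \<forall>r'\<in>?R. r \<le>o r'" by (rule exists_minim_Card_order)
  hence ex: "\<exists>\<kappa> :: 'a rel. Card_order \<kappa> \<and> list_conflict_free TYPE('c) \<F> \<kappa> \<and>
     (\<forall>\<kappa>' :: 'a rel. Card_order \<kappa>' \<and> list_conflict_free TYPE('c) \<F> \<kappa>' \<longrightarrow> \<kappa> \<le>o \<kappa>')"
    by blast
  note * = someI_ex[OF ex, folded list_cf_number_def]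
  from * show "Card_order (list_cf_number TYPE('c) \<F>)" by blast
  from * show "list_conflict_free TYPE('c) \<F> (list_cf_number TYPE('c) \<F>)" by blast
  from * show "\<And>\<kappa> :: 'a rel. Card_order \<kappa> \<Longrightarrow> list_conflict_free TYPE('c) \<F> \<kappa> \<Longrightarrow>
      list_cf_number TYPE('c) \<F> \<le>o \<kappa>" by blast
qed

lemma list_cf_number_least:
  fixes \<F> :: "'a set set" and \<kappa> :: "'k rel"
  assumes "{} \<notin> \<F>" and \<kappa>: "Card_order \<kappa>" "list_conflict_free TYPE('c) \<F> \<kappa>"
  shows "list_cf_number TYPE('c) \<F> \<le>o \<kappa>"
proof (cases "\<kappa> \<le>o |\<Union>\<F>|")
  case True
  then obtain B where B: "B \<subseteq> \<Union>\<F>" "|B| =o \<kappa>"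
    using Card_order_subset[OF \<kappa>(1)] by blast
  have "list_conflict_free TYPE('c) \<F> |B|"
    using list_conflict_free_mono[OF \<kappa>(2)] B(2) ordIso_iff_ordLeq by blast
  hence "list_cf_number TYPE('c) \<F> \<le>o |B|"
    by (rule list_cf_number(3)[OF assms(1) card_of_Card_order])
  thus ?thesis using B(2) by (rule ordLeq_ordIso_trans)
next
  case False
  hence "|\<Union>\<F>| \<le>o \<kappa>" using \<kappa>(1) card_of_Well_order card_order_on_well_order_on ordLeq_total by blast
  moreover have "list_cf_number TYPE('c) \<F> \<le>o |\<Union>\<F>|"
    by (rule list_cf_number(3)[OF assms(1) card_of_Card_order list_conflict_free_card[OF assms(1)]])
  ultimately show ?thesis using ordLeq_transitive by blast
qed

lemma list_conflict_free_color_type: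
  fixes \<F> :: "'a set set" and \<kappa> :: "'a rel"
  assumes inf: "infinite (UNIV :: 'c set)" and le: "|UNIV :: 'a set| \<le>o |UNIV :: 'c set|"
    and \<kappa>: "Card_order \<kappa>" "list_conflict_free TYPE('c) \<F> \<kappa>"
  shows "list_conflict_free TYPE('d) \<F> \<kappa>"
  unfolding list_conflict_free_def
proof (intro allI impI)
  fix L :: "'a \<Rightarrow> 'd set"
  assume L: "\<forall>v\<in>\<Union>\<F>. \<kappa> \<le>o |L v|"
  have "\<exists>S. S \<subseteq> L v \<and> |S| =o \<kappa>" if "v \<in> \<Union>\<F>" for v
    using Card_order_subset[OF \<kappa>(1)] L that by blast
  then obtain S where S: "\<And>v. v \<in> \<Union>\<F> \<Longrightarrow> S v \<subseteq> L v \<and> |S v| =o \<kappa>" by metis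
  have \<kappa>c: "\<kappa> \<le>o |UNIV :: 'c set|"
    by (rule ordIso_ordLeq_trans[OF ordIso_symmetric[OF card_of_Field_ordIso[OF \<kappa>(1)]]
          ordLeq_transitive[OF card_of_mono1[OF subset_UNIV] le]])
  have "|\<Union>v\<in>\<Union>\<F>. S v| \<le>o |UNIV :: 'c set|"
  proof (rule card_of_UNION_ordLeq_infinite[OF inf])
    show "|\<Union>\<F>| \<le>o |UNIV :: 'c set|"
      by (rule ordLeq_transitive[OF card_of_mono1[OF subset_UNIV] le])
    show "\<forall>v\<in>\<Union>\<F>. |S v| \<le>o |UNIV :: 'c set|"
      using S \<kappa>c ordIso_ordLeq_trans by blast
  qed
  then obtain g :: "'d \<Rightarrow> 'c" where g: "inj_on g (\<Union>v\<in>\<Union>\<F>. S v)"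
    by (auto simp: card_of_ordLeq[symmetric])
  have "\<kappa> \<le>o |g ` S v|" if v: "v \<in> \<Union>\<F>" for v
  proof -
    have "inj_on g (S v)" by (rule inj_on_subset[OF g]) (use v in blast)
    hence "|S v| \<le>o |g ` S v|" by (auto simp: card_of_ordLeq[symmetric])
    thus ?thesis using S[OF v] ordIso_ordLeq_trans ordIso_symmetric by blast
  qed
  then obtain c where c: "conflict_free \<F> c" "\<forall>v\<in>\<Union>\<F>. c v \<in> g ` S v"
    using \<kappa>(2)[unfolded list_conflict_free_def, rule_format, of "\<lambda>v. g ` S v"] by blast
  have "\<exists>x. x \<in> S v \<and> g x = c v" if "v \<in> \<Union>\<F>" for v using c(2) that by (metis imageE)
  then obtain d where d: "\<And>v. v \<in> \<Union>\<F> \<Longrightarrow> d v \<in> S v \<and> g (d v) = c v" by metis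
  have "conflict_free \<F> d"
    unfolding conflict_free_def
  proof
    fix A assume A: "A \<in> \<F>"
    then obtain x where x: "x \<in> A" "\<forall>y\<in>A - {x}. c x \<noteq> c y"
      using c(1) unfolding conflict_free_def by blast
    have "d x \<noteq> d y" if "y \<in> A - {x}" for y
      using d[of x] d[of y] x A that by (metis DiffD1 UnionI)
    with x(1) show "\<exists>x\<in>A. \<forall>y\<in>A - {x}. d x \<noteq> d y" by blast
  qed
  moreover have "\<forall>v\<in>\<Union>\<F>. d v \<in> L v" using d S by blast
  ultimately show "\<exists>c. conflict_free \<F> c \<and> (\<forall>v\<in>\<Union>\<F>. c v \<in> L v)" by blast
qed

lemma list_cf_number_color_type:
  fixes \<F> :: "'a set set"
  assumes "{} \<notin> \<F>"
    and "infinite (UNIV :: 'c set)" "|UNIV :: 'a set| \<le>o |UNIV :: 'c set|"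
  shows "list_cf_number TYPE('d) \<F> \<le>o list_cf_number TYPE('c) \<F>"
  by (rule list_cf_number_least[OF assms(1) list_cf_number(1)[OF assms(1)]
        list_conflict_free_color_type[OF assms(2,3)
          list_cf_number(1)[OF assms(1)] list_cf_number(2)[OF assms(1)]]])

end

theory Submission
  imports Defs
begin

text \<open>
  The combinatorial engine is Shelah's revised GCH: for every \<open>X\<close> there are \<open>n\<close> and a family of at most
  \<open>|X|\<close> subsets of \<open>X\<close> such that every \<open>A \<subseteq> X\<close> with \<open>|A| < \<beth>\<^sub>\<omega>(\<nu>)\<close> is a union of at most \<open>\<beth>\<^sub>n(\<nu>)\<close>
  members. In an induction on \<open>|X|\<close> the only difficult case is that of a cardinal \<open>|X|\<close> of countable
  cofinality. If no reduced product of a bounded function \<open>f : \<Theta> \<rightarrow> |X|\<close>, with \<open>|\<Theta>| < \<beth>\<^sub>\<omega>(\<nu>)\<close>, by a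
  \<open>\<sigma>\<close>-complete ideal has size at least \<open>|X|\<close>, then maximal families of pairwise different functions
  yield the required sets. Otherwise an \<open>f\<close> that is minimal modulo the ideal has a reduced product of
  size exactly \<open>|X|\<close> (after restriction to a positive set on which \<open>n\<close> can be chosen uniformly for the
  \<open>f i\<close>), and covers for the \<open>f i\<close> can be glued through it to a cover for \<open>X\<close>. This is the analogue of
  Kunen's proof that an ordinal is moved by the ultrapower embeddings of only finitely many measurable
  cardinals.

  Consequently, every \<open>V\<close> has a family of at most \<open>|V|\<close> subsets of size at least \<open>\<nu>\<close> such that every
  \<open>A \<subseteq> V\<close> of size \<open>\<ge> \<beth>\<^sub>n(\<nu>)\<close>, for some \<open>n\<close> depending on \<open>V\<close>, contains one of them. By \<open>C(\<rho>\<^sup>+, \<nu>)\<close>, only \<open>\<rho>\<close> members of the family contain a given one.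
  So \<open>V\<close> with \<open>|V| > \<rho>\<close> is an increasing union of smaller sets \<open>K v\<close> such that a member of the family
  that first becomes a subset at \<open>K v\<close> meets the union of the earlier \<open>K u\<close> in fewer than \<open>\<rho>\<close> points.
  The new parts can be colored one after the other, by induction on \<open>|V|\<close>, avoiding for each member the
  fewer than \<open>\<rho>\<close> colors it already carries; when \<open>|V| \<le> \<rho>\<close>, the family has size at most \<open>\<rho>\<close>, and an
  injective coloring avoiding all forbidden colors exists.
\<close>

section \<open>Cardinalities\<close>

lemma not_card_of_ordLeq_iff: "\<not> |A| \<le>o |B| \<longleftrightarrow> |B| <o |A|"
  by (simp add: not_ordLeq_iff_ordLess card_of_Well_order)

lemma card_of_ordLeq_trans_subset: "A \<subseteq> B \<Longrightarrow> |B| \<le>o |C| \<Longrightarrow> |A| \<le>o |C|"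
  by (rule ordLeq_transitive[OF card_of_mono1])

lemma card_of_image_ordLeq: "|A| \<le>o |B| \<Longrightarrow> |f ` A| \<le>o |B|"
  by (rule ordLeq_transitive[OF card_of_image])

lemma card_of_inj_image: "inj_on f A \<Longrightarrow> |f ` A| =o |A|"
  using card_of_ordIsoI[of f A "f ` A"] by (simp add: bij_betw_def ordIso_symmetric)

lemma card_of_Pow_ordLeq_mono:
  assumes "|A| \<le>o |B|" shows "|Pow A| \<le>o |Pow B|"
proof -
  obtain f where "inj_on f A" "f ` A \<subseteq> B" using assms by (auto simp: card_of_ordLeq[symmetric])
  thus ?thesis using inj_on_image_Pow[of f A]
    by (intro card_of_ordLeq[THEN iffD1] exI[of _ "(`) f"]) auto
qed

lemma card_of_Times_ordLeq_infinite:
  "infinite C \<Longrightarrow> |A| \<le>o |C| \<Longrightarrow> |B| \<le>o |C| \<Longrightarrow> |A \<times> B| \<le>o |C|"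
  by (rule card_of_Times_ordLeq_infinite_Field) (simp_all add: Field_card_of card_of_card_order_on)

lemma card_of_Un_ordLeq_infinite:
  "infinite C \<Longrightarrow> |A| \<le>o |C| \<Longrightarrow> |B| \<le>o |C| \<Longrightarrow> |A \<union> B| \<le>o |C|"
  by (rule card_of_Un_ordLeq_infinite_Field) (simp_all add: Field_card_of card_of_card_order_on)

lemma finite_ordLeq_infinite: "finite A \<Longrightarrow> infinite B \<Longrightarrow> |A| \<le>o |B|"
  by (metis card_of_ordLeq_finite not_card_of_ordLeq_iff ordLess_imp_ordLeq)

text \<open>\<open>|C|\<close> may be singular: the common bound \<open>|D|\<close> below it keeps
  an infinite union within the size of \<open>I <+> D\<close>, still smaller than
  \<open>|C|\<close>.\<close>

lemma card_of_UNION_ordLess_infinite':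
  assumes inf: "infinite C" and I: "|I| <o |C|" and D: "|D| <o |C|"
    and A: "\<And>i. i \<in> I \<Longrightarrow> |A i| \<le>o |D|"
  shows "|\<Union>i\<in>I. A i| <o |C|"
proof (cases "finite (I <+> D)")
  case True
  hence "finite I" "finite D" by (auto simp: finite_Plus_iff)
  hence "finite (\<Union>i\<in>I. A i)" using A card_of_ordLeq_finite by blast
  thus ?thesis using inf by (metis card_of_ordLeq_finite not_card_of_ordLeq_iff)
next
  case False
  have "|\<Union>i\<in>I. A i| \<le>o |I <+> D|"
    by (rule card_of_UNION_ordLeq_infinite[OF False card_of_Plus1])
      (auto intro: ordLeq_transitive[OF A card_of_Plus2])
  also have "|I <+> D| <o |C|" by (rule card_of_Plus_ordLess_infinite[OF inf I D])
  finally show ?thesis .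
qed

lemma card_of_UNION_nat_ordLeq:
  assumes "infinite C" "\<And>n::nat. |A n| \<le>o |C|"
  shows "|\<Union>n. A n| \<le>o |C|"
  using assms by (intro card_of_UNION_ordLeq_infinite) (auto simp: infinite_iff_card_of_nat[symmetric])

lemma ex_subset_card_of:
  assumes "|A| \<le>o |C|" obtains B where "B \<subseteq> C" "|B| =o |A|"
  using assms internalize_card_of_ordLeq2[of A C] ordIso_symmetric by metis

lemma ex_image_eq_card_of_ordLeq:
  assumes "A \<noteq> {}" "|A| \<le>o |B|" obtains f where "f ` B = A"
  using assms card_of_ordLeq2[of A B] by blast

text \<open>For singular \<open>|C|\<close> a fibre of full size may fail to exist, so only a size
  \<open>|D|\<close> fixed in advance below \<open>|C|\<close> is asked for.\<close>

lemma pigeonhole_infinite_card: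
  assumes inf: "infinite C" and C: "|C| =o |S|" and I: "|I| <o |C|" and D: "|D| <o |C|"
    and g: "\<And>x. x \<in> S \<Longrightarrow> g x \<in> I"
  shows "\<exists>i\<in>I. |D| \<le>o |{x\<in>S. g x = i}|"
proof (rule ccontr)
  assume not: "\<not> ?thesis"
  have "|{x\<in>S. g x = i}| \<le>o |D|" if i: "i \<in> I" for i
  proof (rule ordLess_imp_ordLeq, subst not_card_of_ordLeq_iff[symmetric], rule notI)
    assume "|D| \<le>o |{x\<in>S. g x = i}|"
    with not i show False by blast
  qed
  hence "|\<Union>i\<in>I. {x\<in>S. g x = i}| <o |C|"
    by (intro card_of_UNION_ordLess_infinite'[OF inf I D])
  moreover have "(\<Union>i\<in>I. {x\<in>S. g x = i}) = S" using g by auto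
  ultimately show False using C by (metis not_ordLess_ordIso ordIso_symmetric)
qed

lemma ordLess_cardSuc_card_of: "|A| <o |Field (cardSuc |A| )|"
  by (rule ordLess_ordIso_trans[OF cardSuc_greater[OF card_of_Card_order]
        ordIso_symmetric[OF card_of_Field_ordIso[OF cardSuc_Card_order[OF card_of_Card_order]]]])

lemma Field_cardSuc_ordLeq: "|A| <o |B| \<Longrightarrow> |Field (cardSuc |A| )| \<le>o |B|"
  by (rule ordIso_ordLeq_trans[OF card_of_Field_ordIso[OF cardSuc_Card_order[OF card_of_Card_order]]])
    (simp add: cardSuc_ordLess_ordLeq[symmetric] card_of_Card_order)

lemma ordLess_Field_cardSuc: "|B| <o |Field (cardSuc |A| )| \<Longrightarrow> |B| \<le>o |A|"
  using Field_cardSuc_ordLeq[of A B] not_card_of_ordLeq_iff[of B A]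
    not_card_of_ordLeq_iff[of "Field (cardSuc |A| )" B] by blast

text \<open>If the union were larger, it would have a subset \<open>S\<close> of size
  \<open>|C|\<close>, which fits into no single \<open>T v\<close>. Then every \<open>T v\<close>
  lies inside some set of the chain that contains a point of \<open>S\<close>, and
  \<open>|C|\<close> sets of size below \<open>|C|\<close> exhaust the union.\<close>

lemma chain_Union_ordLeq:
  fixes T :: "'i \<Rightarrow> 'a set"
  assumes inf: "infinite C"
    and chain: "\<And>u v. u \<in> I \<Longrightarrow> v \<in> I \<Longrightarrow> T u \<subseteq> T v \<or> T v \<subseteq> T u"
    and T: "\<And>v. v \<in> I \<Longrightarrow> |T v| <o |C|"
  shows "|\<Union>v\<in>I. T v| \<le>o |C|"
proof (rule ccontr)
  assume not_le: "\<not> ?thesis"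
  hence "|C| \<le>o |\<Union>v\<in>I. T v|" by (simp add: not_card_of_ordLeq_iff ordLess_imp_ordLeq)
  then obtain S where S: "S \<subseteq> (\<Union>v\<in>I. T v)" "|S| =o |C|" by (rule ex_subset_card_of)
  then obtain i where i: "\<And>t. t \<in> S \<Longrightarrow> i t \<in> I \<and> t \<in> T (i t)" by (metis UN_iff subsetD)
  have "T v \<subseteq> (\<Union>t\<in>S. T (i t))" if v: "v \<in> I" for v
  proof -
    have "\<not> S \<subseteq> T v"
      using T[OF v] S(2) card_of_mono1 not_ordLess_ordLeq ordIso_ordLeq_trans ordIso_symmetric by meson
    then obtain t where "t \<in> S" "t \<notin> T v" by blast
    thus ?thesis using chain[OF v, of "i t"] i by blast
  qed
  hence "|\<Union>v\<in>I. T v| \<le>o |\<Union>t\<in>S. T (i t)|" by (intro card_of_mono1) blast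
  also have "|\<Union>t\<in>S. T (i t)| \<le>o |C|"
    by (intro card_of_UNION_ordLeq_infinite[OF inf ordIso_imp_ordLeq[OF S(2)]] ballI
          ordLess_imp_ordLeq T) (use i in blast)
  finally show False using not_le by blast
qed

lemma ex_maximal_pairwise_family:
  fixes R :: "'f \<Rightarrow> 'f \<Rightarrow> bool"
  obtains K where "K \<subseteq> U" "\<And>x y. x \<in> K \<Longrightarrow> y \<in> K \<Longrightarrow> x \<noteq> y \<Longrightarrow> R x y"
    "\<And>x. x \<in> U \<Longrightarrow> x \<in> K \<or> (\<exists>y\<in>K. \<not> R x y \<or> \<not> R y x)"
proof -
  define \<A> where "\<A> = {K. K \<subseteq> U \<and> (\<forall>x\<in>K. \<forall>y\<in>K. x \<noteq> y \<longrightarrow> R x y)}"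
  have "\<exists>M\<in>\<A>. \<forall>X\<in>\<A>. M \<subseteq> X \<longrightarrow> X = M"
  proof (rule Zorn_Lemma, rule ballI)
    fix \<C> assume C: "\<C> \<in> chains \<A>"
    have "R x y" if xy: "x \<in> \<Union>\<C>" "y \<in> \<Union>\<C>" "x \<noteq> y" for x y
    proof -
      obtain K L where KL: "K \<in> \<C>" "L \<in> \<C>" "x \<in> K" "y \<in> L" using xy by blast
      hence "K \<subseteq> L \<or> L \<subseteq> K" using C by (auto simp: chains_def chain_subset_def)
      moreover have "K \<in> \<A>" "L \<in> \<A>" using C KL by (auto simp: chains_def)
      ultimately show ?thesis using KL xy(3) unfolding \<A>_def by blast
    qed
    moreover have "\<Union>\<C> \<subseteq> U" using C unfolding chains_def \<A>_def by blast
    ultimately show "\<Union>\<C> \<in> \<A>" unfolding \<A>_def by blast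
  qed
  then obtain K where K: "K \<in> \<A>" and max: "\<And>X. X \<in> \<A> \<Longrightarrow> K \<subseteq> X \<Longrightarrow> X = K" by blast
  have "x \<in> K \<or> (\<exists>y\<in>K. \<not> R x y \<or> \<not> R y x)" if "x \<in> U" for x
  proof (rule ccontr)
    assume n: "\<not> ?thesis"
    hence "insert x K \<in> \<A>" using K that unfolding \<A>_def by blast
    thus False using max[of "insert x K"] n by blast
  qed
  moreover have "K \<subseteq> U" "\<And>x y. x \<in> K \<Longrightarrow> y \<in> K \<Longrightarrow> x \<noteq> y \<Longrightarrow> R x y"
    using K unfolding \<A>_def by blast+
  ultimately show thesis by (rule that[rotated 2])
qed

lemma card_of_Diff_ordIso:
  assumes "infinite A" "|A \<inter> U| <o |A|" shows "|A - U| =o |A|"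
proof -
  have "\<not> |A - U| <o |A|"
  proof
    assume "|A - U| <o |A|"
    hence "|(A - U) \<union> (A \<inter> U)| <o |A|" by (rule card_of_Un_ordLess_infinite[OF assms(1) _ assms(2)])
    moreover have "(A - U) \<union> (A \<inter> U) = A" by blast
    ultimately have "|A| <o |A|" by simp
    thus False by (rule notE[OF ordLess_irreflexive])
  qed
  hence "|A| \<le>o |A - U|" using not_card_of_ordLeq_iff[of A "A - U"] by blast
  thus ?thesis by (simp add: ordIso_iff_ordLeq card_of_mono1)
qed

section \<open>Initial segments of the well-order \<open>|X|\<close>\<close>

lemma underS_card_of_subset: "underS |X| v \<subseteq> X"
  using Field_card_of[of X] by (auto simp: underS_def Field_def)

lemma underS_card_of_trans: "u \<in> underS |X| v \<Longrightarrow> v \<in> underS |X| w \<Longrightarrow> u \<in> underS |X| w"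
  using card_of_Well_order[of X] unfolding underS_def well_order_on_def linear_order_on_def
    partial_order_on_def preorder_on_def by (auto dest: transD antisymD)

lemma underS_card_of_total:
  "u \<in> X \<Longrightarrow> v \<in> X \<Longrightarrow> u \<notin> underS |X| v \<Longrightarrow> v = u \<or> v \<in> underS |X| u"
  using card_of_Well_order[of X] unfolding underS_def well_order_on_def linear_order_on_def total_on_def
  by (auto simp: Field_card_of)

lemma underS_card_of_less: "v \<in> X \<Longrightarrow> |underS |X| v| <o |X|"
  using card_of_underS[of "|X|" v] card_of_Card_order by (simp add: Field_card_of card_of_card_order_on)

lemma underS_card_of_outside: "v \<notin> X \<Longrightarrow> underS |X| v = {}"
  using Field_card_of[of X] by (auto simp: underS_def Field_def)

lemma underS_card_of_unbounded: "infinite X \<Longrightarrow> u \<in> X \<Longrightarrow> \<exists>v\<in>X. u \<in> underS |X| v"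
  using infinite_Card_order_limit[of "|X|" u] card_of_Card_order
  by (auto simp: Field_card_of card_of_card_order_on underS_def)

lemma wf_card_of: "wf ( |X| - Id)"
  using card_of_Well_order[of X] by (simp add: well_order_on_def)

lemma underS_iff: "u \<in> underS r v \<longleftrightarrow> (u, v) \<in> r - Id"
  by (auto simp: underS_def)

section \<open>Small sets and reduced products\<close>

text \<open>\<open>B n\<close> stands for a set of size beth_n(\<nu>), all of them placed in one
  type. The supremum of their sizes is a strong limit cardinal, called \<lambda> in these
  comments.\<close>

locale beth_seq =
  fixes B :: "nat \<Rightarrow> 'a set"
  assumes infinite_B0: "infinite (B 0)"
    and Pow_B: "|Pow (B n)| \<le>o |B (Suc n)|"
begin

lemma B_less_Suc: "|B n| <o |B (Suc n)|"
  by (rule ordLess_ordLeq_trans[OF card_of_Pow Pow_B])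

lemma B_mono: "n \<le> m \<Longrightarrow> |B n| \<le>o |B m|"
  by (induction m rule: nat_induct_at_least)
    (auto intro: ordLeq_transitive ordLess_imp_ordLeq[OF B_less_Suc] card_of_mono1)

lemma infinite_B: "infinite (B n)"
  using B_mono[of 0 n] infinite_B0 card_of_ordLeq_infinite by blast

text \<open>Size below \<lambda>: as the sizes \<open>|B n|\<close> increase strictly, being bounded
  by one of them is being smaller than their supremum.\<close>

definition small :: "'x set \<Rightarrow> bool" where
  "small A \<longleftrightarrow> (\<exists>n. |A| \<le>o |B n| )"

lemma small_ordLeq: "|A| \<le>o |C| \<Longrightarrow> small C \<Longrightarrow> small A"
  unfolding small_def using ordLeq_transitive by blast

lemma small_subset: "A \<subseteq> C \<Longrightarrow> small C \<Longrightarrow> small A"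
  by (rule small_ordLeq[OF card_of_mono1])

lemma small_image: "small A \<Longrightarrow> small (f ` A)"
  by (rule small_ordLeq[OF card_of_image])

lemma small_B: "small (B n)"
  unfolding small_def by (blast intro: card_of_mono1)

lemma small_Pow: "small A \<Longrightarrow> small (Pow A)"
  unfolding small_def using card_of_Pow_ordLeq_mono ordLeq_transitive Pow_B by blast

lemma small_Times: assumes "small A" "small C" shows "small (A \<times> C)"
proof -
  obtain n m where "|A| \<le>o |B n|" "|C| \<le>o |B m|" using assms unfolding small_def by blast
  hence "|A| \<le>o |B (max n m)|" "|C| \<le>o |B (max n m)|"
    using B_mono[of n "max n m"] B_mono[of m "max n m"] ordLeq_transitive by auto
  thus ?thesis unfolding small_def using card_of_Times_ordLeq_infinite[OF infinite_B] by blast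
qed

text \<open>The revised GCH for one set \<open>Y\<close>; the bound \<open>|B n|\<close> is uniform
  over all small subsets.\<close>

definition coverable :: "'x set \<Rightarrow> nat \<Rightarrow> bool" where
  "coverable Y n \<longleftrightarrow> (\<exists>\<P> \<subseteq> Pow Y. |\<P>| \<le>o |Y| \<and>
     (\<forall>A \<subseteq> Y. small A \<longrightarrow> (\<exists>\<Q> \<subseteq> \<P>. |\<Q>| \<le>o |B n| \<and> A = \<Union>\<Q>)))"

lemma coverable_mono: "coverable Y n \<Longrightarrow> n \<le> m \<Longrightarrow> coverable Y m"
  unfolding coverable_def by (meson B_mono ordLeq_transitive)

lemma coverable_small:
  assumes "small Y" shows "\<exists>n. coverable Y n"
proof -
  obtain n where n: "|Y| \<le>o |B n|" using assms unfolding small_def by blast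
  have "\<exists>\<Q> \<subseteq> (\<lambda>y. {y}) ` Y. |\<Q>| \<le>o |B n| \<and> A = \<Union>\<Q>" if A: "A \<subseteq> Y" for A
    by (rule exI[of _ "(\<lambda>y. {y}) ` A"])
      (use A in \<open>auto intro: card_of_image_ordLeq card_of_ordLeq_trans_subset[OF _ n]\<close>)
  hence "coverable Y n" unfolding coverable_def
    by (intro exI[of _ "(\<lambda>y. {y}) ` Y"]) (auto simp: card_of_image)
  thus ?thesis by blast
qed

lemma small_less_large:
  assumes "\<not> small X" "small Y" shows "|Y| <o |X|"
proof -
  have "\<not> |X| \<le>o |Y|" using assms small_ordLeq by blast
  thus ?thesis by (simp add: not_card_of_ordLeq_iff)
qed

lemma infinite_not_small: "\<not> small X \<Longrightarrow> infinite X"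
  using finite_ordLeq_infinite[OF _ infinite_B] unfolding small_def by blast

end

section \<open>Countably complete ideals and reduced products modulo them\<close>

locale sigma_ideal =
  fixes \<Theta> :: "'i set" and J :: "'i set set"
  assumes ideal_subset: "J \<subseteq> Pow \<Theta>"
    and ideal_empty: "{} \<in> J"
    and ideal_down: "W \<in> J \<Longrightarrow> W' \<subseteq> W \<Longrightarrow> W' \<in> J"
    and ideal_Union: "(\<And>n::nat. U n \<in> J) \<Longrightarrow> (\<Union>n. U n) \<in> J"
    and ideal_proper: "\<Theta> \<notin> J"
begin

lemma ideal_Un: "W \<in> J \<Longrightarrow> W' \<in> J \<Longrightarrow> W \<union> W' \<in> J"
  using ideal_Union[of "\<lambda>n. if n = 0 then W else W'"] by (rule ideal_down) auto

end

text \<open>The ideal \<open>J\<close> concentrated on the positive set \<open>W\<close>. Everything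
  outside \<open>W\<close> is declared null, so that the index set stays \<Theta>.\<close>

lemma sigma_ideal_restrict:
  assumes "sigma_ideal \<Theta> J" "W \<subseteq> \<Theta>" "W \<notin> J"
  shows "sigma_ideal \<Theta> {Y. Y \<subseteq> \<Theta> \<and> Y \<inter> W \<in> J}"
proof -
  interpret sigma_ideal \<Theta> J by fact
  show ?thesis
  proof
    show "{Y. Y \<subseteq> \<Theta> \<and> Y \<inter> W \<in> J} \<subseteq> Pow \<Theta>" by blast
    show "{} \<in> {Y. Y \<subseteq> \<Theta> \<and> Y \<inter> W \<in> J}" using ideal_empty by simp
    show "\<Theta> \<notin> {Y. Y \<subseteq> \<Theta> \<and> Y \<inter> W \<in> J}" using assms by (simp add: Int_absorb1)
  next
    fix Y Y' assume Y: "Y \<in> {Y. Y \<subseteq> \<Theta> \<and> Y \<inter> W \<in> J}" "Y' \<subseteq> Y"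
    have "Y' \<inter> W \<in> J" by (rule ideal_down[of "Y \<inter> W"]) (use Y in auto)
    thus "Y' \<in> {Y. Y \<subseteq> \<Theta> \<and> Y \<inter> W \<in> J}" using Y by auto
  next
    fix U :: "nat \<Rightarrow> 'a set" assume U: "U n \<in> {Y. Y \<subseteq> \<Theta> \<and> Y \<inter> W \<in> J}" for n
    have "(\<Union>n. U n \<inter> W) \<in> J" by (rule ideal_Union) (use U in simp)
    thus "(\<Union>n. U n) \<in> {Y. Y \<subseteq> \<Theta> \<and> Y \<inter> W \<in> J}" using U by auto
  qed
qed

text \<open>In the usual notation for reduced products, \<open>fam J W F S\<close> says that \<open>T\<^bsub>J|W\<^esub>(F) \<ge> |S|\<close>.\<close>

definition fam :: "'i set set \<Rightarrow> 'i set \<Rightarrow> ('i \<Rightarrow> 'x set) \<Rightarrow> 's set \<Rightarrow> bool" where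
  "fam J W F S \<longleftrightarrow> (\<exists>\<phi> :: 's \<Rightarrow> 'i \<Rightarrow> 'x. (\<forall>x\<in>S. {i\<in>W. \<phi> x i \<notin> F i} \<in> J) \<and>
     (\<forall>x\<in>S. \<forall>y\<in>S. x \<noteq> y \<longrightarrow> {i\<in>W. \<phi> x i = \<phi> y i} \<in> J))"

lemma fam_ordLeq:
  assumes "fam J W F S" "|S'| \<le>o |S|" shows "fam J W F S'"
proof -
  obtain \<phi> where \<phi>: "\<forall>x\<in>S. {i\<in>W. \<phi> x i \<notin> F i} \<in> J"
    "\<forall>x\<in>S. \<forall>y\<in>S. x \<noteq> y \<longrightarrow> {i\<in>W. \<phi> x i = \<phi> y i} \<in> J" using assms(1) unfolding fam_def by blast
  obtain h where h: "inj_on h S'" "h ` S' \<subseteq> S" using assms(2) by (auto simp: card_of_ordLeq[symmetric])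
  show ?thesis unfolding fam_def
    by (rule exI[of _ "\<lambda>x. \<phi> (h x)"]) (use \<phi> h in \<open>auto simp: image_subset_iff inj_on_eq_iff\<close>)
qed

context sigma_ideal
begin

lemma fam_null: "W \<in> J \<Longrightarrow> fam J W F S"
  unfolding fam_def by (auto intro: ideal_down)

lemma fam_subset:
  assumes "fam J W F S" "W' \<subseteq> W" shows "fam J W' F S"
proof -
  obtain \<phi> where \<phi>: "\<forall>x\<in>S. {i\<in>W. \<phi> x i \<notin> F i} \<in> J"
    "\<forall>x\<in>S. \<forall>y\<in>S. x \<noteq> y \<longrightarrow> {i\<in>W. \<phi> x i = \<phi> y i} \<in> J" using assms(1) unfolding fam_def by blast
  have "{i\<in>W'. \<phi> x i \<notin> F i} \<in> J" if "x \<in> S" for x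
    by (rule ideal_down[of "{i\<in>W. \<phi> x i \<notin> F i}"]) (use \<phi> assms(2) that in auto)
  moreover have "{i\<in>W'. \<phi> x i = \<phi> y i} \<in> J" if "x \<in> S" "y \<in> S" "x \<noteq> y" for x y
    by (rule ideal_down[of "{i\<in>W. \<phi> x i = \<phi> y i}"]) (use \<phi> assms(2) that in auto)
  ultimately show ?thesis unfolding fam_def by blast
qed

text \<open>At each index the functions of the first \<open>U n\<close> containing it are used. The
  exceptional sets of the glued family lie in countable unions of null sets.\<close>

lemma fam_Union:
  fixes U :: "nat \<Rightarrow> 'i set" and F :: "nat \<Rightarrow> 'i \<Rightarrow> 'x set" and S :: "'s set"
  assumes fam: "\<And>n. fam J (U n) (F n) S"
  shows "fam J (\<Union>n. U n) (\<lambda>i. F (LEAST n. i \<in> U n) i) S"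
proof -
  define \<phi> where "\<phi> n = (SOME \<phi> :: 's \<Rightarrow> 'i \<Rightarrow> 'x. (\<forall>x\<in>S. {i\<in>U n. \<phi> x i \<notin> F n i} \<in> J) \<and>
     (\<forall>x\<in>S. \<forall>y\<in>S. x \<noteq> y \<longrightarrow> {i\<in>U n. \<phi> x i = \<phi> y i} \<in> J))" for n
  have \<phi>: "(\<forall>x\<in>S. {i\<in>U n. \<phi> n x i \<notin> F n i} \<in> J) \<and>
     (\<forall>x\<in>S. \<forall>y\<in>S. x \<noteq> y \<longrightarrow> {i\<in>U n. \<phi> n x i = \<phi> n y i} \<in> J)" for n
    unfolding \<phi>_def by (rule someI_ex[OF fam[of n, unfolded fam_def]])
  define N where "N i = (LEAST n. i \<in> U n)" for i
  have N: "i \<in> U (N i)" if "i \<in> U n" for i n unfolding N_def using that by (rule LeastI)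
  define \<psi> where "\<psi> x i = \<phi> (N i) x i" for x i
  have "{i\<in>\<Union>n. U n. \<psi> x i \<notin> F (N i) i} \<in> J" if x: "x \<in> S" for x
  proof (rule ideal_down[OF ideal_Union])
    show "{i\<in>U n. \<phi> n x i \<notin> F n i} \<in> J" for n using \<phi> x by blast
    show "{i\<in>\<Union>n. U n. \<psi> x i \<notin> F (N i) i} \<subseteq> (\<Union>n. {i\<in>U n. \<phi> n x i \<notin> F n i})"
      unfolding \<psi>_def using N by blast
  qed
  moreover have "{i\<in>\<Union>n. U n. \<psi> x i = \<psi> y i} \<in> J" if x: "x \<in> S" "y \<in> S" "x \<noteq> y" for x y
  proof (rule ideal_down[OF ideal_Union])
    show "{i\<in>U n. \<phi> n x i = \<phi> n y i} \<in> J" for n using \<phi> x by blast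
    show "{i\<in>\<Union>n. U n. \<psi> x i = \<psi> y i} \<subseteq> (\<Union>n. {i\<in>U n. \<phi> n x i = \<phi> n y i})"
      unfolding \<psi>_def using N by blast
  qed
  ultimately show ?thesis unfolding fam_def N_def by blast
qed

text \<open>Take a maximal family of functions in the product modulo \<open>J\<close>, any two of
  them different modulo \<open>J\<close>. It witnesses \<open>fam\<close> for its own size, so it is
  smaller than \<open>S\<close>; by maximality every \<open>G\<close> agrees with a member on a
  positive set.\<close>

lemma not_fam_cover:
  fixes F :: "'i \<Rightarrow> 'x set" and S :: "'s set"
  assumes not: "\<not> fam J W F S"
  obtains K :: "('i \<Rightarrow> 'x) set" where "|K| <o |S|"
    "\<forall>G. (\<forall>i\<in>W. G i \<in> F i) \<longrightarrow> (\<exists>k\<in>K. {i\<in>W. G i = k i} \<notin> J)"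
proof -
  have W: "W \<notin> J" using fam_null not by blast
  define Ug where "Ug = {g. {i\<in>W. g i \<notin> F i} \<in> J}"
  obtain K where K: "K \<subseteq> Ug" "\<And>x y. x \<in> K \<Longrightarrow> y \<in> K \<Longrightarrow> x \<noteq> y \<Longrightarrow> {i\<in>W. x i = y i} \<in> J"
    and max: "\<And>x. x \<in> Ug \<Longrightarrow> x \<in> K \<or> (\<exists>y\<in>K. {i\<in>W. x i = y i} \<notin> J \<or> {i\<in>W. y i = x i} \<notin> J)"
    by (rule ex_maximal_pairwise_family[of Ug "\<lambda>x y. {i\<in>W. x i = y i} \<in> J"]) blast
  have "fam J W F K" unfolding fam_def by (rule exI[of _ "\<lambda>x. x"]) (use K in \<open>auto simp: Ug_def\<close>)
  hence "\<not> |S| \<le>o |K|" using not fam_ordLeq by blast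
  hence "|K| <o |S|" by (simp add: not_card_of_ordLeq_iff)
  moreover have "\<exists>k\<in>K. {i\<in>W. G i = k i} \<notin> J" if G: "\<forall>i\<in>W. G i \<in> F i" for G
  proof -
    have e: "{i\<in>W. G i \<notin> F i} = {}" using G by blast
    have "G \<in> Ug" by (simp only: Ug_def mem_Collect_eq e ideal_empty)
    hence "G \<in> K \<or> (\<exists>y\<in>K. {i\<in>W. G i = y i} \<notin> J)"
      using max[of G] by (simp add: eq_commute)
    moreover have "{i\<in>W. G i = G i} \<notin> J" using W by simp
    ultimately show ?thesis by blast
  qed
  ultimately show thesis by (intro that[of K] allI impI)
qed

end

section \<open>A reduced product of exact size\<close>

locale large_ideal = beth_seq B + sigma_ideal \<Theta> J for B :: "nat \<Rightarrow> 'a set" and \<Theta> :: "'a set" and J +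
  fixes X :: "'a set" and Xs :: "nat \<Rightarrow> 'a set" and nn :: "'a \<Rightarrow> nat"
  assumes small_\<Theta>: "small \<Theta>" and large_X: "\<not> small X"
    and X_Union: "X = (\<Union>n. Xs n)" and Xs_less: "|Xs n| <o |X|"
    and nn: "coverable (underS |X| v) (nn v)"
begin

abbreviation seg :: "'a \<Rightarrow> 'a set" where "seg v \<equiv> underS |X| v"

text \<open>This stands for a reduced product of size at least \<open>|X|\<close>: the sizes
  \<open>|Xs n|\<close> have supremum \<open>|X|\<close>, and the witnessing family may change with
  \<open>n\<close>.\<close>

definition large :: "'a set \<Rightarrow> ('a \<Rightarrow> 'a) \<Rightarrow> bool" where
  "large W f \<longleftrightarrow> (\<forall>n. fam J W (\<lambda>i. seg (f i)) (Xs n))"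

lemma infinite_X: "infinite X"
  using infinite_not_small[OF large_X] .

lemma card_Pow_\<Theta>: "|Pow \<Theta>| <o |X|"
  by (rule small_less_large[OF large_X small_Pow[OF small_\<Theta>]])

text \<open>By countable completeness a sequence descending modulo \<open>J\<close> descends at
  every index outside one null set, and a single such index gives an infinite descent in
  \<open>X\<close>.\<close>

lemma wf_mod_ideal: "wf {(g, f). {i\<in>\<Theta>. g i \<notin> seg (f i)} \<in> J}"
  unfolding wf_iff_no_infinite_down_chain
proof
  assume "\<exists>s. \<forall>k. (s (Suc k), s k) \<in> {(g, f). {i\<in>\<Theta>. g i \<notin> seg (f i)} \<in> J}"
  then obtain s where s: "\<And>k. {i\<in>\<Theta>. s (Suc k) i \<notin> seg (s k i)} \<in> J" by blast
  have "(\<Union>k. {i\<in>\<Theta>. s (Suc k) i \<notin> seg (s k i)}) \<in> J" by (rule ideal_Union) (rule s)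
  hence "(\<Union>k. {i\<in>\<Theta>. s (Suc k) i \<notin> seg (s k i)}) \<noteq> \<Theta>" using ideal_proper by metis
  then obtain i where "i \<in> \<Theta>" "\<And>k. s (Suc k) i \<in> seg (s k i)" by blast
  hence "\<exists>t. \<forall>k. (t (Suc k), t k) \<in> |X| - Id" by (intro exI[of _ "\<lambda>k. s k i"]) (simp add: underS_iff)
  thus False using wf_card_of[of X] unfolding wf_iff_no_infinite_down_chain by blast
qed

definition below :: "('a \<Rightarrow> 'a) \<Rightarrow> 'a set set" where
  "below f = {W. W \<subseteq> \<Theta> \<and> (\<exists>g. {i\<in>W. g i \<notin> seg (f i)} \<in> J \<and> large W g)}"

text \<open>Properness is the minimality of \<open>f\<close>. For countable unions the witnesses
  \<open>g\<close> are glued, taking at each index the first set that contains it.\<close>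

lemma sigma_ideal_below:
  assumes min: "\<And>g. {i\<in>\<Theta>. g i \<notin> seg (f i)} \<in> J \<Longrightarrow> \<not> large \<Theta> g"
  shows "sigma_ideal \<Theta> (below f)"
proof
  show "below f \<subseteq> Pow \<Theta>" by (auto simp: below_def)
  show "{} \<in> below f" by (auto simp: below_def large_def ideal_empty fam_null)
  show "\<Theta> \<notin> below f" using min by (auto simp: below_def)
next
  fix W W' assume W: "W \<in> below f" "W' \<subseteq> W"
  then obtain g where g: "{i\<in>W. g i \<notin> seg (f i)} \<in> J" "large W g" by (auto simp: below_def)
  have "{i\<in>W'. g i \<notin> seg (f i)} \<in> J" by (rule ideal_down[OF g(1)]) (use W(2) in blast)
  moreover have "large W' g" using g(2) fam_subset W(2) unfolding large_def by blast
  ultimately show "W' \<in> below f" using W unfolding below_def by blast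
next
  fix U :: "nat \<Rightarrow> 'a set" assume U: "U n \<in> below f" for n
  hence "\<exists>g. {i\<in>U n. g i \<notin> seg (f i)} \<in> J \<and> large (U n) g" for n by (auto simp: below_def)
  then obtain g where g: "\<And>n. {i\<in>U n. g n i \<notin> seg (f i)} \<in> J" "\<And>n. large (U n) (g n)" by metis
  define h where "h i = g (LEAST n. i \<in> U n) i" for i
  have L: "i \<in> U (LEAST n. i \<in> U n)" if "i \<in> U n" for i n using that by (rule LeastI)
  have "{i\<in>\<Union>n. U n. h i \<notin> seg (f i)} \<in> J"
  proof (rule ideal_down[OF ideal_Union])
    show "{i\<in>U n. g n i \<notin> seg (f i)} \<in> J" for n by (rule g)
    show "{i\<in>\<Union>n. U n. h i \<notin> seg (f i)} \<subseteq> (\<Union>n. {i\<in>U n. g n i \<notin> seg (f i)})"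
      unfolding h_def using L by blast
  qed
  moreover have "large (\<Union>n. U n) h"
    unfolding large_def h_def
    by (intro allI fam_Union[of U "\<lambda>n i. seg (g n i)"]) (use g(2) in \<open>simp add: large_def\<close>)
  ultimately show "(\<Union>n. U n) \<in> below f" using U unfolding below_def by blast
qed

text \<open>A strictly larger family would contain, below one of its members, \<open>|X|\<close> many functions modulo
  the ideal \<open>below f\<close>, contradicting the definition of that ideal.\<close>

lemma minimal_not_fam:
  assumes min: "\<And>g. {i\<in>\<Theta>. g i \<notin> seg (f i)} \<in> J \<Longrightarrow> \<not> large \<Theta> g"
  shows "\<not> fam J \<Theta> (\<lambda>i. seg (f i)) (Field (cardSuc |X| ))"
proof
  let ?S = "Field (cardSuc |X| )"
  let ?J1 = "below f"
  interpret J1: sigma_ideal \<Theta> ?J1 using min by (rule sigma_ideal_below)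
  assume "fam J \<Theta> (\<lambda>i. seg (f i)) ?S"
  then obtain \<phi> :: "'a set \<Rightarrow> 'a \<Rightarrow> 'a" where \<phi>': "(\<forall>x\<in>?S. {i\<in>\<Theta>. \<phi> x i \<notin> seg (f i)} \<in> J) \<and>
      (\<forall>x\<in>?S. \<forall>y\<in>?S. x \<noteq> y \<longrightarrow> {i\<in>\<Theta>. \<phi> x i = \<phi> y i} \<in> J)"
    unfolding fam_def by (rule exE)
  have \<phi>: "\<And>x. x \<in> ?S \<Longrightarrow> {i\<in>\<Theta>. \<phi> x i \<notin> seg (f i)} \<in> J"
    using \<phi>' by simp
  have diff: "\<And>x y. x \<in> ?S \<Longrightarrow> y \<in> ?S \<Longrightarrow> x \<noteq> y \<Longrightarrow> {i\<in>\<Theta>. \<phi> x i = \<phi> y i} \<in> J"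
    using \<phi>' by simp
  \<comment> \<open>On a null set any function is a witness; the identity is taken.\<close>
  have J_J1: "W \<in> ?J1" if W: "W \<in> J" for W
  proof -
    have "{i\<in>W. i \<notin> seg (f i)} \<in> J" by (rule ideal_down[OF W]) blast
    moreover have "large W (\<lambda>i. i)" unfolding large_def by (intro allI fam_null[OF W])
    moreover have "W \<subseteq> \<Theta>" using W ideal_subset by blast
    ultimately show ?thesis unfolding below_def by (intro CollectI conjI exI[of _ "\<lambda>i. i"])
  qed
  have in_J1: "W \<in> ?J1" if "W \<subseteq> \<Theta>" "x \<in> ?S" "large W (\<phi> x)" for W x
  proof -
    have "{i\<in>W. \<phi> x i \<notin> seg (f i)} \<in> J" by (rule ideal_down[OF \<phi>[OF that(2)]]) (use that(1) in blast)
    thus ?thesis using that unfolding below_def by blast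
  qed
  have fam_sub: "fam J W (\<lambda>i. seg (\<phi> y i)) T"
    if "W \<subseteq> \<Theta>" "T \<subseteq> ?S" "\<And>x i. x \<in> T \<Longrightarrow> i \<in> W \<Longrightarrow> \<phi> x i \<in> seg (\<phi> y i)" for W T y
    unfolding fam_def
  proof (intro exI[of _ \<phi>] conjI ballI impI)
    fix x assume "x \<in> T"
    hence "{i\<in>W. \<phi> x i \<notin> seg (\<phi> y i)} = {}" using that(3) by blast
    thus "{i\<in>W. \<phi> x i \<notin> seg (\<phi> y i)} \<in> J" using ideal_empty by metis
  next
    fix x z assume "x \<in> T" "z \<in> T" "x \<noteq> z"
    hence "{i\<in>\<Theta>. \<phi> x i = \<phi> z i} \<in> J" using diff that(2) by blast
    thus "{i\<in>W. \<phi> x i = \<phi> z i} \<in> J" by (rule ideal_down) (use that(1) in blast)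
  qed
  define less where "less x y = {i\<in>\<Theta>. \<phi> x i \<in> seg (\<phi> y i)}" for x y
  have less_\<Theta>: "less x y \<in> Pow \<Theta>" for x y unfolding less_def by blast
  \<comment> \<open>The functions below \<open>\<phi> x\<close> on a set positive for
    \<open>below f\<close>. If \<open>|X|\<close> many were below it on the same set
    \<open>W\<close>, then \<open>\<phi> x\<close> would be large on \<open>W\<close> and
    \<open>W\<close> would be null. Since \<open>W\<close> ranges over \<open>Pow \<Theta>\<close>,
    there are at most \<open>|X|\<close> of them.\<close>
  define Bx where "Bx x = {y\<in>?S. less y x \<notin> ?J1}" for x
  have Bx: "|Bx x| \<le>o |X|" if x: "x \<in> ?S" for x
  proof -
    have "|{y\<in>?S. less y x = W}| \<le>o |X|" if W: "W \<in> Pow \<Theta> - ?J1" for W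
    proof (rule ccontr)
      assume "\<not> ?thesis"
      hence "|X| \<le>o |{y\<in>?S. less y x = W}|" by (simp add: not_card_of_ordLeq_iff ordLess_imp_ordLeq)
      moreover have "fam J W (\<lambda>i. seg (\<phi> x i)) {y\<in>?S. less y x = W}"
        by (rule fam_sub) (use W in \<open>auto simp: less_def\<close>)
      ultimately have "fam J W (\<lambda>i. seg (\<phi> x i)) (Xs n)" for n
        using fam_ordLeq ordLeq_transitive ordLess_imp_ordLeq[OF Xs_less] by blast
      hence "large W (\<phi> x)" by (simp add: large_def)
      thus False using in_J1 W x by blast
    qed
    hence "|\<Union>W\<in>Pow \<Theta> - ?J1. {y\<in>?S. less y x = W}| \<le>o |X|"
      by (intro card_of_UNION_ordLeq_infinite[OF infinite_X
            card_of_ordLeq_trans_subset[OF Diff_subset ordLess_imp_ordLeq[OF card_Pow_\<Theta>]]] ballI)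
    moreover have "Bx x \<subseteq> (\<Union>W\<in>Pow \<Theta> - ?J1. {y\<in>?S. less y x = W})"
      unfolding Bx_def using less_\<Theta> by blast
    ultimately show ?thesis by (rule card_of_ordLeq_trans_subset[rotated])
  qed
  obtain S0 where S0: "S0 \<subseteq> ?S" "|S0| =o |X|"
    using ordLess_imp_ordLeq[OF ordLess_cardSuc_card_of] by (rule ex_subset_card_of)
  have S0X: "|S0| \<le>o |X|" by (rule ordIso_imp_ordLeq[OF S0(2)])
  have "|\<Union>x\<in>S0. Bx x| \<le>o |X|"
    using Bx S0(1) by (intro card_of_UNION_ordLeq_infinite[OF infinite_X S0X]) blast
  hence "|(\<Union>x\<in>S0. Bx x) \<union> S0| \<le>o |X|"
    by (rule card_of_Un_ordLeq_infinite[OF infinite_X _ S0X])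
  hence "\<not> ?S \<subseteq> (\<Union>x\<in>S0. Bx x) \<union> S0"
    using card_of_ordLeq_trans_subset[of ?S "(\<Union>x\<in>S0. Bx x) \<union> S0" X] ordLess_cardSuc_card_of[of X]
      not_card_of_ordLeq_iff[of ?S X] by blast
  then obtain y where y: "y \<in> ?S" "y \<notin> S0" "\<And>x. x \<in> S0 \<Longrightarrow> y \<notin> Bx x" by blast
  \<comment> \<open>\<open>\<phi> y\<close> equals \<open>\<phi> x\<close> or lies below it only on
    a null set of \<open>below f\<close>. Hence it lies above \<open>\<phi> x\<close> off the null
    set \<open>Z x\<close>.\<close>
  define Z where "Z x = \<Theta> - less x y" for x
  have Z: "Z x \<in> ?J1" if x: "x \<in> S0" for x
  proof (rule J1.ideal_down)
    have xS: "x \<in> ?S" using x S0 by blast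
    have "less y x \<in> ?J1" using y(3)[OF x] y(1) by (simp add: Bx_def)
    moreover have "{i\<in>\<Theta>. \<phi> x i = \<phi> y i} \<in> ?J1" using J_J1 diff[OF xS y(1)] x y(2) by blast
    moreover have "{i\<in>\<Theta>. \<phi> x i \<notin> seg (f i)} \<in> ?J1" "{i\<in>\<Theta>. \<phi> y i \<notin> seg (f i)} \<in> ?J1"
      using J_J1 \<phi> xS y(1) by blast+
    ultimately show "(less y x \<union> {i\<in>\<Theta>. \<phi> x i = \<phi> y i}) \<union>
        ({i\<in>\<Theta>. \<phi> x i \<notin> seg (f i)} \<union> {i\<in>\<Theta>. \<phi> y i \<notin> seg (f i)}) \<in> ?J1"
      by (intro J1.ideal_Un)
    show "Z x \<subseteq> (less y x \<union> {i\<in>\<Theta>. \<phi> x i = \<phi> y i}) \<union>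
        ({i\<in>\<Theta>. \<phi> x i \<notin> seg (f i)} \<union> {i\<in>\<Theta>. \<phi> y i \<notin> seg (f i)})"
      unfolding Z_def less_def using underS_card_of_total[of _ X] underS_card_of_subset[of X] by blast
  qed
  \<comment> \<open>One exceptional set \<open>E n\<close> is shared by at least
    \<open>|Xs n|\<close> of the \<open>x\<close>. As \<open>|X|\<close> has countable cofinality,
    countably many \<open>E n\<close> suffice for largeness.\<close>
  have "\<exists>W\<in>?J1. |Xs n| \<le>o |{x\<in>S0. Z x = W}|" for n
  proof -
    have "\<exists>W\<in>Pow \<Theta> \<inter> ?J1. |Xs n| \<le>o |{x\<in>S0. Z x = W}|"
    proof (rule pigeonhole_infinite_card[OF infinite_X ordIso_symmetric[OF S0(2)] _ Xs_less])
      show "|Pow \<Theta> \<inter> ?J1| <o |X|"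
        by (rule ordLeq_ordLess_trans[OF card_of_mono1 card_Pow_\<Theta>]) blast
      show "Z x \<in> Pow \<Theta> \<inter> ?J1" if "x \<in> S0" for x using Z[OF that] by (auto simp: Z_def)
    qed
    thus ?thesis by blast
  qed
  hence "\<forall>n. \<exists>W. W \<in> ?J1 \<and> |Xs n| \<le>o |{x\<in>S0. Z x = W}|" by blast
  from choice[OF this] obtain E where
    E': "\<forall>n. E n \<in> ?J1 \<and> |Xs n| \<le>o |{x\<in>S0. Z x = E n}|" by (rule exE)
  hence E: "\<And>n. E n \<in> ?J1" "\<And>n. |Xs n| \<le>o |{x\<in>S0. Z x = E n}|" by simp_all
  \<comment> \<open>Off all the \<open>E n\<close> the function \<open>\<phi> y\<close> is large, so
    that this set is in the ideal as well and \<Theta> would be null.\<close>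
  define W where "W = \<Theta> - (\<Union>n. E n)"
  have "fam J W (\<lambda>i. seg (\<phi> y i)) (Xs n)" for n
  proof (rule fam_ordLeq[OF fam_sub E(2)])
    show "W \<subseteq> \<Theta>" by (auto simp: W_def)
    show "{x\<in>S0. Z x = E n} \<subseteq> ?S" using S0 by blast
    show "\<phi> x i \<in> seg (\<phi> y i)" if "x \<in> {x\<in>S0. Z x = E n}" "i \<in> W" for x i
      using that unfolding W_def Z_def less_def by blast
  qed
  hence "large W (\<phi> y)" by (simp add: large_def)
  hence "W \<in> ?J1" by (rule in_J1[rotated 2]) (use y(1) in \<open>auto simp: W_def\<close>)
  moreover have "(\<Union>n. E n) \<in> ?J1" using E(1) by (rule J1.ideal_Union)
  ultimately have "W \<union> (\<Union>n. E n) \<in> ?J1" by (rule J1.ideal_Un)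
  moreover have "W \<union> (\<Union>n. E n) = \<Theta>" using J1.ideal_subset E(1) unfolding W_def by blast
  ultimately show False using J1.ideal_proper by simp
qed

text \<open>A function \<open>f\<close> minimal among the large ones carries no family of size
  \<open>|X|\<^sup>+\<close>. On one of countably many pieces of \<Theta> this stays true, by
  gluing, while the lower bound passes to all pieces. The pieces are formed by the level at which
  the segment below \<open>f i\<close> is covered.\<close>

lemma ex_exact_cover:
  assumes "large \<Theta> f0"
  obtains W f N and \<phi> :: "nat \<Rightarrow> 'a \<Rightarrow> 'a \<Rightarrow> 'a" and K :: "('a \<Rightarrow> 'a) set" where "W \<subseteq> \<Theta>"
    "\<forall>i\<in>W. coverable (seg (f i)) N"
    "\<forall>n. (\<forall>x\<in>Xs n. \<forall>i\<in>W. \<phi> n x i \<in> seg (f i)) \<and>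
      (\<forall>x\<in>Xs n. \<forall>y\<in>Xs n. x \<noteq> y \<longrightarrow> {i\<in>W. \<phi> n x i = \<phi> n y i} \<in> J)"
    "|K| \<le>o |X|"
    "\<forall>G. (\<forall>i\<in>W. G i \<in> seg (f i)) \<longrightarrow> (\<exists>k\<in>K. {i\<in>W. G i = k i} \<notin> J)"
proof -
  obtain f where f: "large \<Theta> f" and min: "\<And>g. {i\<in>\<Theta>. g i \<notin> seg (f i)} \<in> J \<Longrightarrow> \<not> large \<Theta> g"
  proof (rule wfE_min[OF wf_mod_ideal, of f0 "{f. large \<Theta> f}"])
    show "f0 \<in> {f. large \<Theta> f}" using assms by simp
  qed simp
  let ?S = "Field (cardSuc |X| )"
  \<comment> \<open>Indices with an empty segment are set apart in \<open>U 0\<close>, so that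
    functions on the other pieces can take values in \<open>seg (f i)\<close> everywhere.
    \<open>U 0\<close> is null because some \<open>Xs n\<close> has a point.\<close>
  define U where "U n = (if n = 0 then {i\<in>\<Theta>. seg (f i) = {}} else {i\<in>\<Theta>. nn (f i) \<le> n \<and> seg (f i) \<noteq> {}})" for n
  have U\<Theta>: "(\<Union>n. U n) = \<Theta>"
  proof
    show "(\<Union>n. U n) \<subseteq> \<Theta>" by (auto simp: U_def split: if_splits)
    have "i \<in> U 0 \<or> i \<in> U (Suc (nn (f i)))" if "i \<in> \<Theta>" for i using that by (auto simp: U_def)
    thus "\<Theta> \<subseteq> (\<Union>n. U n)" by blast
  qed
  have "\<exists>n. \<not> fam J (U n) (\<lambda>i. seg (f i)) ?S"
  proof (rule ccontr)
    assume "\<not> ?thesis"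
    hence "fam J (\<Union>n. U n) (\<lambda>i. seg (f i)) ?S" by (intro fam_Union) blast
    thus False using minimal_not_fam[OF min] U\<Theta> by simp
  qed
  then obtain N where N: "\<not> fam J (U N) (\<lambda>i. seg (f i)) ?S" by blast
  have "X \<noteq> {}" using infinite_X by auto
  then obtain n x where x: "x \<in> Xs n" using X_Union by blast
  have "U 0 \<in> J"
  proof -
    have "fam J \<Theta> (\<lambda>i. seg (f i)) (Xs n)" using f by (simp add: large_def)
    then obtain \<phi> :: "'a \<Rightarrow> 'a \<Rightarrow> 'a" where "\<forall>x\<in>Xs n. {i\<in>\<Theta>. \<phi> x i \<notin> seg (f i)} \<in> J"
      unfolding fam_def by (elim exE conjE)
    hence "{i\<in>\<Theta>. \<phi> x i \<notin> seg (f i)} \<in> J" using x by simp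
    thus ?thesis by (rule ideal_down) (auto simp: U_def)
  qed
  hence "N \<noteq> 0" using N fam_null by metis
  define W where "W = U N"
  have W\<Theta>: "W \<subseteq> \<Theta>" and ne: "\<And>i. i \<in> W \<Longrightarrow> seg (f i) \<noteq> {}" and nn_le: "\<And>i. i \<in> W \<Longrightarrow> nn (f i) \<le> N"
    using \<open>N \<noteq> 0\<close> by (auto simp: W_def U_def)
  have "\<exists>\<phi>. (\<forall>x\<in>Xs n. \<forall>i\<in>W. \<phi> x i \<in> seg (f i)) \<and>
      (\<forall>x\<in>Xs n. \<forall>y\<in>Xs n. x \<noteq> y \<longrightarrow> {i\<in>W. \<phi> x i = \<phi> y i} \<in> J)" for n
  proof -
    have "fam J \<Theta> (\<lambda>i. seg (f i)) (Xs n)" using f by (simp add: large_def)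
    then obtain \<psi> :: "'a \<Rightarrow> 'a \<Rightarrow> 'a" where \<psi>: "\<forall>x\<in>Xs n. {i\<in>\<Theta>. \<psi> x i \<notin> seg (f i)} \<in> J"
      "\<forall>x\<in>Xs n. \<forall>y\<in>Xs n. x \<noteq> y \<longrightarrow> {i\<in>\<Theta>. \<psi> x i = \<psi> y i} \<in> J"
      unfolding fam_def by (elim exE conjE)
    \<comment> \<open>The values of \<open>\<psi> x\<close> outside the segments occur on a null set
      only; replacing them by an arbitrary default keeps the functions different modulo
      \<open>J\<close>.\<close>
    define \<phi> where "\<phi> x i = (if \<psi> x i \<in> seg (f i) then \<psi> x i else (SOME y. y \<in> seg (f i)))" for x i
    have "\<phi> x i \<in> seg (f i)" if "i \<in> W" for x i
      unfolding \<phi>_def using ne[OF that] by (auto intro: someI)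
    moreover have "{i\<in>W. \<phi> x i = \<phi> y i} \<in> J" if "x \<in> Xs n" "y \<in> Xs n" "x \<noteq> y" for x y
    proof (rule ideal_down)
      show "({i\<in>\<Theta>. \<psi> x i \<notin> seg (f i)} \<union> {i\<in>\<Theta>. \<psi> y i \<notin> seg (f i)}) \<union> {i\<in>\<Theta>. \<psi> x i = \<psi> y i} \<in> J"
        using \<psi> that by (intro ideal_Un) blast+
      show "{i\<in>W. \<phi> x i = \<phi> y i} \<subseteq>
          ({i\<in>\<Theta>. \<psi> x i \<notin> seg (f i)} \<union> {i\<in>\<Theta>. \<psi> y i \<notin> seg (f i)}) \<union> {i\<in>\<Theta>. \<psi> x i = \<psi> y i}"
        using W\<Theta> by (auto simp: \<phi>_def)
    qed
    ultimately show ?thesis by (intro exI[of _ \<phi>] conjI ballI impI)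
  qed
  hence "\<forall>n. \<exists>\<phi>. (\<forall>x\<in>Xs n. \<forall>i\<in>W. \<phi> x i \<in> seg (f i)) \<and>
      (\<forall>x\<in>Xs n. \<forall>y\<in>Xs n. x \<noteq> y \<longrightarrow> {i\<in>W. \<phi> x i = \<phi> y i} \<in> J)" by (rule allI)
  from choice[OF this] obtain \<phi> where \<phi>: "\<forall>n. (\<forall>x\<in>Xs n. \<forall>i\<in>W. \<phi> n x i \<in> seg (f i)) \<and>
      (\<forall>x\<in>Xs n. \<forall>y\<in>Xs n. x \<noteq> y \<longrightarrow> {i\<in>W. \<phi> n x i = \<phi> n y i} \<in> J)" by (rule exE)
  obtain K where K: "|K| <o |?S|"
    "\<forall>G. (\<forall>i\<in>W. G i \<in> seg (f i)) \<longrightarrow> (\<exists>k\<in>K. {i\<in>W. G i = k i} \<notin> J)"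
    by (rule not_fam_cover[OF N[folded W_def]])
  show thesis
    by (rule that[OF W\<Theta> ballI[OF coverable_mono[OF nn nn_le]] \<phi> ordLess_Field_cardSuc[OF K(1)] K(2)])
qed

text \<open>A small \<open>A \<subseteq> Xs n\<close> is cut into classes on which all the projections \<open>x \<mapsto> \<phi> n x i\<close> stay within one
  piece of a cover of \<open>seg (f i)\<close>. Such a choice of pieces is coded by an element of the product of the
  \<open>seg (f i)\<close>, hence determined by a member of \<open>K\<close> up to boundedly many possibilities.\<close>

lemma large_imp_coverable:
  assumes "large \<Theta> f0"
  shows "\<exists>M. coverable X M"
proof -
  obtain W f N and \<phi> :: "nat \<Rightarrow> 'a \<Rightarrow> 'a \<Rightarrow> 'a" and K :: "('a \<Rightarrow> 'a) set" where W: "W \<subseteq> \<Theta>"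
    and cov: "\<forall>i\<in>W. coverable (seg (f i)) N"
    and \<phi>': "\<forall>n. (\<forall>x\<in>Xs n. \<forall>i\<in>W. \<phi> n x i \<in> seg (f i)) \<and>
      (\<forall>x\<in>Xs n. \<forall>y\<in>Xs n. x \<noteq> y \<longrightarrow> {i\<in>W. \<phi> n x i = \<phi> n y i} \<in> J)"
    and K: "|K| \<le>o |X|"
    and KG: "\<forall>G. (\<forall>i\<in>W. G i \<in> seg (f i)) \<longrightarrow> (\<exists>k\<in>K. {i\<in>W. G i = k i} \<notin> J)"
    by (rule ex_exact_cover[OF assms])
  have \<phi>: "\<And>n x i. x \<in> Xs n \<Longrightarrow> i \<in> W \<Longrightarrow> \<phi> n x i \<in> seg (f i)"
    and diff: "\<And>n x y. x \<in> Xs n \<Longrightarrow> y \<in> Xs n \<Longrightarrow> x \<noteq> y \<Longrightarrow> {i\<in>W. \<phi> n x i = \<phi> n y i} \<in> J"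
    using \<phi>' by simp_all
  have "\<forall>i\<in>W. \<exists>P. P \<subseteq> Pow (seg (f i)) \<and> |P| \<le>o |seg (f i)| \<and>
      (\<forall>A \<subseteq> seg (f i). small A \<longrightarrow> (\<exists>\<Q> \<subseteq> P. |\<Q>| \<le>o |B N| \<and> A = \<Union>\<Q>))"
    using cov by (simp add: coverable_def)
  from bchoice[OF this] obtain P where P': "\<forall>i\<in>W. P i \<subseteq> Pow (seg (f i)) \<and> |P i| \<le>o |seg (f i)| \<and>
      (\<forall>A \<subseteq> seg (f i). small A \<longrightarrow> (\<exists>\<Q> \<subseteq> P i. |\<Q>| \<le>o |B N| \<and> A = \<Union>\<Q>))" by (rule exE)
  have P: "\<exists>\<Q> \<subseteq> P i. |\<Q>| \<le>o |B N| \<and> A = \<Union>\<Q>" if "i \<in> W" "A \<subseteq> seg (f i)" "small A" for i A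
    using P' that by simp
  \<comment> \<open>Pieces of the cover of \<open>seg (f i)\<close> are coded by points of
    \<open>seg (f i)\<close>. A choice of one piece for each \<open>i\<close> thus becomes an
    element of the product, to which \<open>K\<close> applies; \<open>R\<close> decodes it.\<close>
  have "\<forall>i\<in>W. \<exists>e. inj_on e (P i) \<and> e ` P i \<subseteq> seg (f i)"
    using P' by (simp add: card_of_ordLeq)
  from bchoice[OF this] obtain e where e: "\<forall>i\<in>W. inj_on (e i) (P i) \<and> e i ` P i \<subseteq> seg (f i)" by (rule exE)
  define R where "R k i = \<Union>{Q\<in>P i. e i Q = k i}" for k i
  have R: "R k i = Q" if iQ: "i \<in> W" "Q \<in> P i" "e i Q = k i" for k i Q
  proof -
    have inj: "inj_on (e i) (P i)" using e iQ(1) by simp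
    have "Q' = Q" if "Q' \<in> P i" "e i Q' = k i" for Q'
      using inj_onD[OF inj, of Q' Q] that iQ by simp
    hence "{Q\<in>P i. e i Q = k i} = {Q}" using iQ by blast
    thus ?thesis by (simp add: R_def)
  qed
  define Box where "Box n Y k = {x\<in>Xs n. \<forall>i\<in>Y. \<phi> n x i \<in> R k i}" for n Y k
  define \<P> where "\<P> = (\<Union>n. \<Union>Y\<in>Pow \<Theta>. \<Union>k\<in>K. if small (Box n Y k) then Pow (Box n Y k) else {})"
  have X_leq: "|A| \<le>o |X|" if "small A" for A :: "'z set"
    by (rule ordLess_imp_ordLeq[OF small_less_large[OF large_X that]])
  have \<P>X: "|\<P>| \<le>o |X|" unfolding \<P>_def
    by (intro card_of_UNION_nat_ordLeq card_of_UNION_ordLeq_infinite ballI infinite_X K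
        ordLess_imp_ordLeq[OF card_Pow_\<Theta>])
      (auto intro: X_leq[OF small_Pow] card_of_empty)
  \<comment> \<open>The level \<open>M\<close> bounds the number of codes used below. It depends
    neither on \<open>n\<close> nor on the set to be covered.\<close>
  have "small (Pow (\<Theta> \<times> B N))" by (intro small_Pow small_Times small_\<Theta> small_B)
  then obtain M where M: "|Pow (\<Theta> \<times> B N)| \<le>o |B M|" unfolding small_def by (rule exE)
  have piece: "\<exists>\<Q> \<subseteq> \<P>. |\<Q>| \<le>o |B M| \<and> A = \<Union>\<Q>" if A: "A \<subseteq> Xs n" "small A" for A n
  proof -
    let ?A = "\<lambda>i. (\<lambda>x. \<phi> n x i) ` A"
    have "\<forall>i\<in>W. \<exists>\<Q>. \<Q> \<subseteq> P i \<and> |\<Q>| \<le>o |B N| \<and> ?A i = \<Union>\<Q>"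
    proof
      fix i assume i: "i \<in> W"
      have "?A i \<subseteq> seg (f i)" using \<phi> i A by blast
      from P[OF i this small_image[OF A(2)]]
      show "\<exists>\<Q>. \<Q> \<subseteq> P i \<and> |\<Q>| \<le>o |B N| \<and> ?A i = \<Union>\<Q>" by simp
    qed
    from bchoice[OF this] obtain \<Q> where
      \<Q>: "\<forall>i\<in>W. \<Q> i \<subseteq> P i \<and> |\<Q> i| \<le>o |B N| \<and> ?A i = \<Union>(\<Q> i)" by (rule exE)
    hence "\<forall>i\<in>W. \<exists>b. inj_on b (\<Q> i) \<and> b ` \<Q> i \<subseteq> B N" by (simp add: card_of_ordLeq)
    from bchoice[OF this] obtain b where b: "\<forall>i\<in>W. inj_on (b i) (\<Q> i) \<and> b i ` \<Q> i \<subseteq> B N" by (rule exE)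
    define q where "q i x = (SOME Q. Q \<in> \<Q> i \<and> \<phi> n x i \<in> Q)" for i x
    have q: "q i x \<in> \<Q> i \<and> \<phi> n x i \<in> q i x" if "i \<in> W" "x \<in> A" for i x
    proof -
      have "\<phi> n x i \<in> ?A i" using that by blast
      hence "\<phi> n x i \<in> \<Union>(\<Q> i)" using \<Q> that by simp
      hence "\<exists>Q. Q \<in> \<Q> i \<and> \<phi> n x i \<in> Q" by blast
      thus ?thesis unfolding q_def by (rule someI_ex)
    qed
    \<comment> \<open>\<open>code x\<close> records, by elements of \<open>B N\<close>, which piece
      was chosen for each projection of \<open>x\<close>; \<open>cl\<close> collects the points of
      \<open>A\<close> with the same record.\<close>
    define code where "code x = (\<lambda>i. (i, b i (q i x))) ` W" for x
    define cl where "cl c = {x\<in>A. code x = c}" for c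
    have "code x \<in> Pow (\<Theta> \<times> B N)" if "x \<in> A" for x
      using q that b W unfolding code_def by fast
    hence "code ` A \<subseteq> Pow (\<Theta> \<times> B N)" by blast
    hence "|cl ` code ` A| \<le>o |B M|"
      by (intro card_of_image_ordLeq card_of_ordLeq_trans_subset[OF _ M])
    moreover have "A = \<Union>(cl ` code ` A)" by (auto simp: cl_def)
    moreover have "cl ` code ` A \<subseteq> \<P>"
    proof (rule image_subsetI, elim imageE, hypsubst)
      fix x0 assume x0: "x0 \<in> A"
      have P0: "q i x0 \<in> P i" if "i \<in> W" for i using q[OF that x0] \<Q> that by blast
      have "\<forall>i\<in>W. e i (q i x0) \<in> seg (f i)" using e P0 by blast
      \<comment> \<open>The pieces chosen for \<open>x0\<close> give a function in the product. It
        agrees with some \<open>k\<close> in \<open>K\<close> on a positive set, where decoding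
        \<open>k\<close> returns these pieces.\<close>
      with KG obtain k where k: "k \<in> K" and Y: "{i\<in>W. e i (q i x0) = k i} \<notin> J"
        by (elim allE[of _ "\<lambda>i. e i (q i x0)"]) auto
      define Y where "Y = {i\<in>W. e i (q i x0) = k i}"
      have Rq: "R k i = q i x0" if "i \<in> Y" for i
        using that P0 by (intro R) (auto simp: Y_def)
      have "cl (code x0) \<subseteq> Box n Y k"
      proof
        fix x assume "x \<in> cl (code x0)"
        hence x: "x \<in> A" "code x = code x0" by (auto simp: cl_def)
        have "\<phi> n x i \<in> R k i" if i: "i \<in> Y" for i
        proof -
          have iW: "i \<in> W" using i by (simp add: Y_def)
          have inj: "inj_on (b i) (\<Q> i)" using b iW by simp
          have "(i, b i (q i x)) \<in> code x" unfolding code_def by (rule image_eqI[OF refl iW])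
          hence "b i (q i x) = b i (q i x0)" unfolding x(2) by (auto simp: code_def)
          hence "q i x = q i x0" using inj_onD[OF inj, of "q i x" "q i x0"] q[OF iW x(1)] q[OF iW x0] by simp
          thus ?thesis using q[OF iW x(1)] Rq[OF i] by simp
        qed
        thus "x \<in> Box n Y k" using x A unfolding Box_def by blast
      qed
      \<comment> \<open>A point of the box is determined by its projections on \<open>Y\<close>:
        different points agree only on a null set, and \<open>Y\<close> is positive. These
        projections lie in pieces contained in projections of \<open>A\<close>, so they range over a
        small set.\<close>
      moreover have "small (Box n Y k)"
      proof -
        define g where "g x = (\<lambda>i. (i, \<phi> n x i)) ` Y" for x
        have "inj_on g (Box n Y k)"
        proof (rule inj_onI, rule ccontr)
          fix x y assume xy: "x \<in> Box n Y k" "y \<in> Box n Y k" "g x = g y" "x \<noteq> y"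
          have "Y \<subseteq> {i\<in>W. \<phi> n x i = \<phi> n y i}"
          proof
            fix i assume i: "i \<in> Y"
            hence "(i, \<phi> n x i) \<in> g x" unfolding g_def by (rule image_eqI[OF refl])
            hence "\<phi> n x i = \<phi> n y i" unfolding xy(3) by (auto simp: g_def)
            thus "i \<in> {i\<in>W. \<phi> n x i = \<phi> n y i}" using i by (simp add: Y_def)
          qed
          moreover have "{i\<in>W. \<phi> n x i = \<phi> n y i} \<in> J" using diff xy by (simp add: Box_def)
          ultimately have "Y \<in> J" by (rule ideal_down[rotated])
          thus False using Y by (simp add: Y_def)
        qed
        moreover have "g ` Box n Y k \<subseteq> Pow (\<Theta> \<times> (\<lambda>(i, x). \<phi> n x i) ` (\<Theta> \<times> A))"
        proof (rule image_subsetI)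
          fix x assume x: "x \<in> Box n Y k"
          have "\<phi> n x i \<in> (\<lambda>(i, x). \<phi> n x i) ` (\<Theta> \<times> A)" if i: "i \<in> Y" for i
          proof -
            have iW: "i \<in> W" using i by (simp add: Y_def)
            have "\<phi> n x i \<in> R k i" using x i by (simp add: Box_def)
            hence "\<phi> n x i \<in> q i x0" using Rq i by simp
            hence "\<phi> n x i \<in> \<Union>(\<Q> i)" using q[OF iW x0] by blast
            hence "\<phi> n x i \<in> ?A i" using \<Q> iW by simp
            thus ?thesis using W iW by (auto simp: image_iff)
          qed
          thus "g x \<in> Pow (\<Theta> \<times> (\<lambda>(i, x). \<phi> n x i) ` (\<Theta> \<times> A))"
            unfolding g_def using W by (auto simp: Y_def)
        qed
        ultimately have "|Box n Y k| \<le>o |Pow (\<Theta> \<times> (\<lambda>(i, x). \<phi> n x i) ` (\<Theta> \<times> A))|"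
          by (intro card_of_ordLeq[THEN iffD1] exI conjI)
        thus ?thesis
          by (rule small_ordLeq) (intro small_Pow small_Times small_image small_\<Theta> A(2))
      qed
      moreover have "Y \<in> Pow \<Theta>" using W by (auto simp: Y_def)
      ultimately have "cl (code x0) \<in> (if small (Box n Y k) then Pow (Box n Y k) else {})" by simp
      thus "cl (code x0) \<in> \<P>" unfolding \<P>_def using k \<open>Y \<in> Pow \<Theta>\<close> by blast
    qed
    ultimately show ?thesis by (intro exI[of _ "cl ` code ` A"] conjI)
  qed
  have "\<exists>\<Q> \<subseteq> \<P>. |\<Q>| \<le>o |B M| \<and> A = \<Union>\<Q>" if A: "A \<subseteq> X" "small A" for A
  proof -
    have "\<forall>n. \<exists>\<Q>. \<Q> \<subseteq> \<P> \<and> |\<Q>| \<le>o |B M| \<and> A \<inter> Xs n = \<Union>\<Q>"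
      by (intro allI piece[OF Int_lower2 small_subset[OF Int_lower1 A(2)]])
    from choice[OF this] obtain \<Q> where \<Q>: "\<forall>n. \<Q> n \<subseteq> \<P> \<and> |\<Q> n| \<le>o |B M| \<and> A \<inter> Xs n = \<Union>(\<Q> n)" by (rule exE)
    have "|\<Union>n. \<Q> n| \<le>o |B M|" using \<Q> by (intro card_of_UNION_nat_ordLeq infinite_B) simp
    moreover have "A = \<Union>(\<Union>n. \<Q> n)"
    proof -
      have "A = (\<Union>n. A \<inter> Xs n)" using A(1) X_Union by blast
      also have "\<dots> = (\<Union>n. \<Union>(\<Q> n))" using \<Q> by simp
      finally show ?thesis by blast
    qed
    moreover have "(\<Union>n. \<Q> n) \<subseteq> \<P>" using \<Q> by blast
    ultimately show ?thesis by (intro exI[of _ "\<Union>n. \<Q> n"] conjI)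
  qed
  moreover have "\<P> \<subseteq> Pow X" unfolding \<P>_def Box_def X_Union by (auto split: if_splits)
  ultimately have "coverable X M" unfolding coverable_def using \<P>X by (intro exI[of _ \<P>]) simp
  thus ?thesis by (rule exI)
qed

end

section \<open>The revised GCH\<close>

context beth_seq
begin

text \<open>The pieces are images of subsets of \<open>B m\<close> under members of the families
  from \<open>not_fam_cover\<close>. For \<open>A\<close> enumerated by \<open>h\<close> on
  \<open>B m\<close>, the sets whose images are covered by countably many pieces form an ideal. Were
  it proper, \<open>h\<close> would agree with a member on a positive set whose image is a piece. So
  countably many pieces suffice, whence level 0.\<close>

lemma coverable_if_no_large_fam:
  fixes X :: "'a set" and Xs :: "nat \<Rightarrow> 'a set"
  assumes large_X: "\<not> small X" and X: "X = (\<Union>n. Xs n)" and Xs: "\<And>n. |Xs n| <o |X|"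
    and no: "\<And>m J k. sigma_ideal (B m) J \<Longrightarrow> \<exists>n. \<not> fam J (B m) (\<lambda>i. Xs k) (Xs n)"
  shows "coverable X 0"
proof -
  have infX: "infinite X" by (rule infinite_not_small[OF large_X])
  have ex: "\<exists>K. |K| \<le>o |X| \<and>
      (\<forall>G. (\<forall>i\<in>B m. G i \<in> Xs k) \<longrightarrow> (\<exists>g\<in>K. {i\<in>B m. G i = g i} \<notin> J))"
    if J: "sigma_ideal (B m) J" for m J k
  proof -
    from no[OF J] obtain n where "\<not> fam J (B m) (\<lambda>i. Xs k) (Xs n)" by (rule exE)
    then obtain K where "|K| <o |Xs n|"
      "\<forall>G. (\<forall>i\<in>B m. G i \<in> Xs k) \<longrightarrow> (\<exists>g\<in>K. {i\<in>B m. G i = g i} \<notin> J)"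
      by (rule sigma_ideal.not_fam_cover[OF J])
    moreover from this(1) have "|K| \<le>o |X|"
      by (rule ordLess_imp_ordLeq[OF ordLess_transitive[OF _ Xs]])
    ultimately show ?thesis by (intro exI[of _ K] conjI)
  qed
  define K where "K m J k = (SOME K. |K| \<le>o |X| \<and>
      (\<forall>G. (\<forall>i\<in>B m. G i \<in> Xs k) \<longrightarrow> (\<exists>g\<in>K. {i\<in>B m. G i = g i} \<notin> J)))" for m J k
  have K: "|K m J k| \<le>o |X| \<and>
      (\<forall>G. (\<forall>i\<in>B m. G i \<in> Xs k) \<longrightarrow> (\<exists>g\<in>K m J k. {i\<in>B m. G i = g i} \<notin> J))"
    if J: "sigma_ideal (B m) J" for m J k unfolding K_def by (rule someI_ex[OF ex[OF J]])
  define \<P>0 where "\<P>0 = (\<Union>m. \<Union>J\<in>{J. sigma_ideal (B m) J}. \<Union>k. \<Union>g\<in>K m J k. \<Union>Y\<in>Pow (B m). {g ` Y})"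
  define \<P> where "\<P> = insert {} (\<P>0 \<inter> Pow X)"
  have X_leq: "|A| \<le>o |X|" if "small A" for A :: "'z set"
    by (rule ordLess_imp_ordLeq[OF small_less_large[OF large_X that]])
  have ideals: "|{J. sigma_ideal (B m) J}| \<le>o |X|" for m
  proof (rule X_leq[OF small_subset])
    show "{J. sigma_ideal (B m) J} \<subseteq> Pow (Pow (B m))" by (auto simp: sigma_ideal_def)
    show "small (Pow (Pow (B m)))" by (intro small_Pow small_B)
  qed
  have sing: "|{a}| \<le>o |X|" for a by (rule finite_ordLeq_infinite[OF _ infX]) simp
  have "|\<P>0| \<le>o |X|" unfolding \<P>0_def
    by (intro card_of_UNION_nat_ordLeq card_of_UNION_ordLeq_infinite ballI infX ideals
        X_leq[OF small_Pow[OF small_B]] sing) (use K in simp)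
  hence "|\<P>| \<le>o |X|" unfolding \<P>_def
    by (subst insert_is_Un)
      (rule card_of_Un_ordLeq_infinite[OF infX sing card_of_ordLeq_trans_subset[OF Int_lower1]])
  moreover have "\<P> \<subseteq> Pow X" by (auto simp: \<P>_def)
  moreover have "\<exists>\<Q> \<subseteq> \<P>. |\<Q>| \<le>o |B 0| \<and> A = \<Union>\<Q>" if A: "A \<subseteq> X" "small A" for A
  proof (cases "A = {}")
    case True
    thus ?thesis by (intro exI[of _ "{}"]) (simp add: card_of_empty)
  next
    case False
    \<comment> \<open>A subset of an image is the image of a subset, so that pieces can finally be
      cut down to \<open>A\<close>.\<close>
    have P_down: "Z \<in> \<P>" if Z: "Z \<subseteq> Q" and Q: "Q \<in> \<P>" for Z Q
    proof (cases "Q = {}")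
      case True thus ?thesis using Z by (simp add: \<P>_def)
    next
      case False
      hence Q': "Q \<in> \<P>0" "Q \<subseteq> X" using Q by (auto simp: \<P>_def)
      from Q'(1) obtain m J k g Y where mJ: "sigma_ideal (B m) J" "g \<in> K m J k" "Y \<subseteq> B m" and "Q = g ` Y"
        unfolding \<P>0_def by blast
      with Q'(2) have "Z = g ` (Y \<inter> g -` Z)" "Z \<subseteq> X" "Y \<inter> g -` Z \<in> Pow (B m)" using Z by auto
      thus ?thesis unfolding \<P>_def \<P>0_def using mJ by blast
    qed
    obtain m where "|A| \<le>o |B m|" using A unfolding small_def by (elim exE)
    with False obtain h where h: "h ` B m = A" by (rule ex_image_eq_card_of_ordLeq)
    define J where "J = {Y. Y \<subseteq> B m \<and> (\<exists>q :: nat \<Rightarrow> 'a set. (\<forall>n. q n \<in> \<P>) \<and> h ` Y \<subseteq> (\<Union>n. q n))}"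
    have P_J: "Y \<in> J" if "Y \<subseteq> B m" "h ` Y \<in> \<P>" for Y
      unfolding J_def using that by (intro CollectI conjI exI[of _ "\<lambda>n. h ` Y"]) auto
    have "B m \<in> J"
    proof (rule ccontr)
      assume proper: "B m \<notin> J"
      have sJ: "sigma_ideal (B m) J"
      proof
        show "J \<subseteq> Pow (B m)" by (auto simp: J_def)
        show "{} \<in> J" by (rule P_J) (auto simp: \<P>_def)
        show "B m \<notin> J" by fact
      next
        fix W W' assume W: "W \<in> J" "W' \<subseteq> W"
        then obtain q :: "nat \<Rightarrow> 'a set" where "\<forall>n. q n \<in> \<P>" "h ` W \<subseteq> (\<Union>n. q n)" by (auto simp: J_def)
        moreover from this(2) have "h ` W' \<subseteq> (\<Union>n. q n)" using W(2) by blast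
        moreover have "W' \<subseteq> B m" using W by (auto simp: J_def)
        ultimately show "W' \<in> J" unfolding J_def by (intro CollectI conjI exI[of _ q])
      next
        fix U :: "nat \<Rightarrow> 'a set" assume U: "U n \<in> J" for n
        hence "\<forall>n. \<exists>q :: nat \<Rightarrow> 'a set. (\<forall>k. q k \<in> \<P>) \<and> h ` U n \<subseteq> (\<Union>k. q k)" by (simp add: J_def)
        from choice[OF this] obtain q :: "nat \<Rightarrow> nat \<Rightarrow> 'a set"
          where q: "\<forall>n. (\<forall>k. q n k \<in> \<P>) \<and> h ` U n \<subseteq> (\<Union>k. q n k)" by (rule exE)
        have "|UNIV :: (nat \<times> nat) set| \<le>o |UNIV :: nat set|"
          using card_of_Times_same_infinite[of "UNIV :: nat set"] by (simp add: ordIso_imp_ordLeq)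
        then obtain d :: "nat \<Rightarrow> nat \<times> nat" where d: "range d = UNIV"
          by (rule ex_image_eq_card_of_ordLeq[OF UNIV_not_empty])
        have "h ` (\<Union>n. U n) \<subseteq> (\<Union>l. case d l of (n, k) \<Rightarrow> q n k)"
        proof (rule image_subsetI)
          fix x assume "x \<in> (\<Union>n. U n)"
          then obtain n where "x \<in> U n" by blast
          hence "h x \<in> (\<Union>k. q n k)" using q by blast
          then obtain k where "h x \<in> q n k" by blast
          moreover obtain l where "d l = (n, k)" using surjD[OF d] by metis
          ultimately have "h x \<in> (case d l of (n, k) \<Rightarrow> q n k)" by simp
          thus "h x \<in> (\<Union>l. case d l of (n, k) \<Rightarrow> q n k)" by (rule UN_I[OF UNIV_I])
        qed
        moreover have "(case d l of (n, k) \<Rightarrow> q n k) \<in> \<P>" for l using q by (simp split: prod.split)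
        moreover have "(\<Union>n. U n) \<subseteq> B m" using U by (auto simp: J_def)
        ultimately show "(\<Union>n. U n) \<in> J"
          unfolding J_def by (intro CollectI conjI exI[of _ "\<lambda>l. case d l of (n, k) \<Rightarrow> q n k"] allI)
      qed
      interpret sigma_ideal "B m" J by (rule sJ)
      \<comment> \<open>The families \<open>K m J k\<close> serve only functions into a single
        \<open>Xs k\<close>. By countable completeness \<open>h\<close> maps some positive set into
        one.\<close>
      have "\<exists>k. B m \<inter> h -` Xs k \<notin> J"
      proof (rule ccontr)
        assume "\<not> ?thesis"
        hence "(\<Union>k. B m \<inter> h -` Xs k) \<in> J" by (intro ideal_Union) blast
        moreover have "(\<Union>k. B m \<inter> h -` Xs k) = B m" using h A(1) X by blast
        ultimately show False using proper by simp
      qed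
      then obtain k where k: "B m \<inter> h -` Xs k \<notin> J" by (rule exE)
      define W where "W = B m \<inter> h -` Xs k"
      define J' where "J' = {Y. Y \<subseteq> B m \<and> Y \<inter> W \<in> J}"
      have W: "W \<notin> J" "W \<subseteq> B m" using k by (auto simp: W_def)
      have J': "sigma_ideal (B m) J'" unfolding J'_def by (rule sigma_ideal_restrict[OF sJ W(2,1)])
      have "W \<noteq> {}" using W(1) ideal_empty by auto
      then obtain w where w: "h w \<in> Xs k" by (auto simp: W_def)
      \<comment> \<open>Off \<open>W\<close> a default value in \<open>Xs k\<close> is used, which
        the ideal \<open>J'\<close> does not see.\<close>
      define G where "G i = (if i \<in> W then h i else h w)" for i
      have "\<forall>i\<in>B m. G i \<in> Xs k" using w by (simp add: G_def W_def)
      with K[OF J', of k] obtain g where g: "g \<in> K m J' k" "{i\<in>B m. G i = g i} \<notin> J'" by blast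
      let ?Y = "{i\<in>W. h i = g i}"
      have "{i\<in>B m. G i = g i} \<inter> W = ?Y" using W by (auto simp: G_def)
      hence YJ: "?Y \<notin> J" using g(2) by (auto simp: J'_def)
      have "h ` ?Y = g ` ?Y" by (intro image_cong) auto
      moreover have "h ` ?Y \<subseteq> X" using h A W by blast
      moreover have "?Y \<in> Pow (B m)" using W by blast
      ultimately have "h ` ?Y \<in> \<P>" unfolding \<P>_def \<P>0_def using J' g(1) by blast
      hence "?Y \<in> J" by (intro P_J) (use W in auto)
      thus False using YJ by contradiction
    qed
    then obtain q :: "nat \<Rightarrow> 'a set" where q: "\<forall>n. q n \<in> \<P>" "A \<subseteq> (\<Union>n. q n)" by (auto simp: J_def h)
    have "(\<lambda>n. A \<inter> q n) ` UNIV \<subseteq> \<P>" using q(1) P_down by blast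
    moreover have "|(\<lambda>n. A \<inter> q n) ` (UNIV :: nat set)| \<le>o |B 0|"
      using infinite_B0 by (intro card_of_image_ordLeq) (simp add: infinite_iff_card_of_nat)
    moreover have "A = \<Union>((\<lambda>n. A \<inter> q n) ` UNIV)" using q(2) by blast
    ultimately show ?thesis by (intro exI[of _ "(\<lambda>n. A \<inter> q n) ` UNIV"] conjI)
  qed
  ultimately show ?thesis unfolding coverable_def by (intro exI[of _ \<P>]) simp
qed

text \<open>The covers of cofinally many segments are put together. If a small set of these segments
  is cofinal, \<open>A\<close> is cut along it, whence the level \<open>max m n\<close>; otherwise
  every small \<open>A\<close> lies inside a single segment.\<close>

lemma coverable_if_cofinal:
  fixes X :: "'a set"
  assumes large_X: "\<not> small X"
    and cof: "\<And>u. u \<in> X \<Longrightarrow> \<exists>v\<in>X. u \<in> underS |X| v \<and> coverable (underS |X| v) n"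
  shows "\<exists>M. coverable X M"
proof -
  have infX: "infinite X" by (rule infinite_not_small[OF large_X])
  define C where "C = {v\<in>X. coverable (underS |X| v) n}"
  have "\<forall>v\<in>C. \<exists>P. P \<subseteq> Pow (underS |X| v) \<and> |P| \<le>o |underS |X| v| \<and>
      (\<forall>A \<subseteq> underS |X| v. small A \<longrightarrow> (\<exists>\<Q> \<subseteq> P. |\<Q>| \<le>o |B n| \<and> A = \<Union>\<Q>))"
    by (simp add: C_def coverable_def)
  from bchoice[OF this] obtain P where P: "\<forall>v\<in>C. P v \<subseteq> Pow (underS |X| v) \<and> |P v| \<le>o |underS |X| v| \<and>
      (\<forall>A \<subseteq> underS |X| v. small A \<longrightarrow> (\<exists>\<Q> \<subseteq> P v. |\<Q>| \<le>o |B n| \<and> A = \<Union>\<Q>))" by (rule exE)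
  define \<P> where "\<P> = (\<Union>v\<in>C. P v)"
  have CX: "C \<subseteq> X" by (auto simp: C_def)
  have "|P v| \<le>o |X|" if "v \<in> C" for v
    by (rule ordLeq_transitive[OF _ card_of_mono1[OF underS_card_of_subset[of X v]]]) (use P that in simp)
  hence \<P>X: "|\<P>| \<le>o |X|" unfolding \<P>_def
    by (intro card_of_UNION_ordLeq_infinite infX card_of_mono1[OF CX]) blast
  have "P v \<subseteq> Pow X" if "v \<in> C" for v
    by (rule subset_trans[OF _ Pow_mono[OF underS_card_of_subset[of X v]]]) (use P that in simp)
  hence sub: "\<P> \<subseteq> Pow X" unfolding \<P>_def by blast
  show ?thesis
  proof (cases "\<exists>D\<subseteq>C. small D \<and> (\<forall>x\<in>X. \<exists>d\<in>D. x \<in> underS |X| d)")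
    case True
    then obtain D where D: "D \<subseteq> C" "small D" "\<forall>x\<in>X. \<exists>d\<in>D. x \<in> underS |X| d" by (elim exE conjE)
    from D(2) obtain m where m: "|D| \<le>o |B m|" unfolding small_def by (rule exE)
    let ?M = "max m n"
    have "\<exists>\<Q> \<subseteq> \<P>. |\<Q>| \<le>o |B ?M| \<and> A = \<Union>\<Q>" if A: "A \<subseteq> X" "small A" for A
    proof -
      have "\<forall>d\<in>D. \<exists>\<Q>. \<Q> \<subseteq> P d \<and> |\<Q>| \<le>o |B n| \<and> A \<inter> underS |X| d = \<Union>\<Q>"
      proof
        fix d assume "d \<in> D"
        hence "d \<in> C" using D by blast
        with P have "\<forall>A \<subseteq> underS |X| d. small A \<longrightarrow> (\<exists>\<Q> \<subseteq> P d. |\<Q>| \<le>o |B n| \<and> A = \<Union>\<Q>)" by simp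
        thus "\<exists>\<Q>. \<Q> \<subseteq> P d \<and> |\<Q>| \<le>o |B n| \<and> A \<inter> underS |X| d = \<Union>\<Q>"
          using small_subset[OF _ A(2), of "A \<inter> underS |X| d"] by simp
      qed
      from bchoice[OF this] obtain \<Q> where
        \<Q>: "\<forall>d\<in>D. \<Q> d \<subseteq> P d \<and> |\<Q> d| \<le>o |B n| \<and> A \<inter> underS |X| d = \<Union>(\<Q> d)" by (rule exE)
      have "|\<Q> d| \<le>o |B ?M|" if "d \<in> D" for d
        by (rule ordLeq_transitive[OF _ B_mono[of n ?M]]) (use \<Q> that in simp_all)
      hence "|\<Union>d\<in>D. \<Q> d| \<le>o |B ?M|"
        using ordLeq_transitive[OF m B_mono[of m ?M]] by (intro card_of_UNION_ordLeq_infinite infinite_B) auto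
      moreover have "A = \<Union>(\<Union>d\<in>D. \<Q> d)"
      proof -
        have "A = (\<Union>d\<in>D. A \<inter> underS |X| d)" using D(3) A(1) by blast
        also have "\<dots> = (\<Union>d\<in>D. \<Union>(\<Q> d))" using \<Q> by simp
        finally show ?thesis by blast
      qed
      moreover have "\<Q> d \<subseteq> P d" if "d \<in> D" for d using \<Q> that by simp
      hence "(\<Union>d\<in>D. \<Q> d) \<subseteq> \<P>" unfolding \<P>_def using D(1) by blast
      ultimately show ?thesis by (intro exI[of _ "\<Union>d\<in>D. \<Q> d"] conjI)
    qed
    hence "coverable X ?M" unfolding coverable_def using \<P>X sub by (intro exI[of _ \<P>]) simp
    thus ?thesis by (rule exI)
  next
    case False
    have "\<exists>\<Q> \<subseteq> \<P>. |\<Q>| \<le>o |B n| \<and> A = \<Union>\<Q>" if A: "A \<subseteq> X" "small A" for A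
    proof -
      have "\<forall>a\<in>A. \<exists>v. v \<in> C \<and> a \<in> underS |X| v" using cof A(1) unfolding C_def by blast
      from bchoice[OF this] obtain v where v: "\<forall>a\<in>A. v a \<in> C \<and> a \<in> underS |X| (v a)" by (rule exE)
      have "\<not> (\<forall>x\<in>X. \<exists>d\<in>v ` A. x \<in> underS |X| d)"
      proof
        assume "\<forall>x\<in>X. \<exists>d\<in>v ` A. x \<in> underS |X| d"
        moreover have "v ` A \<subseteq> C" using v by auto
        ultimately have "\<exists>D\<subseteq>C. small D \<and> (\<forall>x\<in>X. \<exists>d\<in>D. x \<in> underS |X| d)"
          using small_image[OF A(2)] by (intro exI[of _ "v ` A"] conjI)
        thus False using False by contradiction
      qed
      then obtain x where x: "x \<in> X" "\<And>a. a \<in> A \<Longrightarrow> x \<notin> underS |X| (v a)" by blast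
      obtain y where y: "y \<in> C" "x \<in> underS |X| y" using cof[OF x(1)] unfolding C_def by blast
      have "a \<in> underS |X| y" if a: "a \<in> A" for a
      proof -
        have va: "v a \<in> X" "a \<in> underS |X| (v a)" using v a CX by auto
        have "v a = x \<or> v a \<in> underS |X| x" by (rule underS_card_of_total[OF x(1) va(1) x(2)[OF a]])
        hence "v a \<in> underS |X| y" using y(2) underS_card_of_trans by metis
        thus ?thesis using va(2) underS_card_of_trans by metis
      qed
      hence "A \<subseteq> underS |X| y" by blast
      moreover have "\<forall>A \<subseteq> underS |X| y. small A \<longrightarrow> (\<exists>\<Q> \<subseteq> P y. |\<Q>| \<le>o |B n| \<and> A = \<Union>\<Q>)" using P y(1) by simp
      ultimately have "\<exists>\<Q> \<subseteq> P y. |\<Q>| \<le>o |B n| \<and> A = \<Union>\<Q>" using A(2) by simp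
      moreover have "P y \<subseteq> \<P>" using y(1) unfolding \<P>_def by blast
      ultimately show ?thesis by blast
    qed
    hence "coverable X n" unfolding coverable_def using \<P>X sub by (intro exI[of _ \<P>]) simp
    thus ?thesis by (rule exI)
  qed
qed

text \<open>This is Shelah's revised GCH for the strong limit cardinal \<open>sup\<^sub>n |B n|\<close>.\<close>

theorem ex_coverable:
  fixes X :: "'a set"
  shows "\<exists>n. coverable X n"
proof (induction X rule: wf_induct[OF wf_inv_image[OF wf_ordLess, of card_of]])
  case (1 X)
  hence IH: "\<exists>n. coverable Y n" if "|Y| <o |X|" for Y :: "'a set" using that by (simp add: inv_image_def)
  show ?case
  proof (cases "small X")
    case True
    thus ?thesis by (rule coverable_small)
  next
    case large_X: False
    have infX: "infinite X" by (rule infinite_not_small[OF large_X])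
    have "\<forall>v. \<exists>n. coverable (underS |X| v) n"
    proof
      fix v show "\<exists>n. coverable (underS |X| v) n"
      proof (cases "v \<in> X")
        case True thus ?thesis by (intro IH underS_card_of_less)
      next
        case False
        have "small (underS |X| v)" unfolding underS_card_of_outside[OF False] small_def
          by (simp add: card_of_empty)
        thus ?thesis by (rule coverable_small)
      qed
    qed
    from choice[OF this] obtain nn where nn: "\<forall>v. coverable (underS |X| v) (nn v)" by (rule exE)
    show ?thesis
    proof (cases "\<exists>n. \<forall>u\<in>X. \<exists>v\<in>X. u \<in> underS |X| v \<and> nn v \<le> n")
      case True
      then obtain n where n: "\<forall>u\<in>X. \<exists>v\<in>X. u \<in> underS |X| v \<and> nn v \<le> n" by (rule exE)
      show ?thesis
        by (rule coverable_if_cofinal[OF large_X, of n]) (use n nn coverable_mono in blast)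
    next
      case False
      \<comment> \<open>Above \<open>u n\<close> all levels exceed \<open>n\<close>. So every
        \<open>y\<close> is at or below \<open>u (nn y)\<close>, and the segments below the
        \<open>u n\<close> exhaust \<open>X\<close>.\<close>
      hence "\<forall>n. \<exists>u. u \<in> X \<and> (\<forall>v\<in>X. u \<in> underS |X| v \<longrightarrow> \<not> nn v \<le> n)" by blast
      from choice[OF this] obtain u where
        u: "\<forall>n. u n \<in> X \<and> (\<forall>v\<in>X. u n \<in> underS |X| v \<longrightarrow> \<not> nn v \<le> n)" by (rule exE)
      define Xs where "Xs n = underS |X| (u n)" for n
      have Xs_less: "|Xs n| <o |X|" for n unfolding Xs_def using u by (intro underS_card_of_less) simp
      have X_Un: "X = (\<Union>n. Xs n)"
      proof
        show "(\<Union>n. Xs n) \<subseteq> X" unfolding Xs_def by (rule UN_least) (rule underS_card_of_subset)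
        show "X \<subseteq> (\<Union>n. Xs n)"
        proof
          fix x assume "x \<in> X"
          then obtain y where y: "y \<in> X" "x \<in> underS |X| y" using underS_card_of_unbounded[OF infX] by blast
          have "u (nn y) \<notin> underS |X| y" using u y(1) by blast
          hence "y = u (nn y) \<or> y \<in> underS |X| (u (nn y))"
            using underS_card_of_total[of "u (nn y)" X y] u y(1) by simp
          hence "x \<in> Xs (nn y)" unfolding Xs_def using y(2) underS_card_of_trans by metis
          thus "x \<in> (\<Union>n. Xs n)" by blast
        qed
      qed
      show ?thesis
      proof (cases "\<exists>m J k. sigma_ideal (B m) J \<and> (\<forall>n. fam J (B m) (\<lambda>i. Xs k) (Xs n))")
        case True
        then obtain m J k where J: "sigma_ideal (B m) J" "\<forall>n. fam J (B m) (\<lambda>i. Xs k) (Xs n)" by blast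
        interpret large_ideal B "B m" J X Xs nn
          using J(1) nn large_X X_Un Xs_less small_B beth_seq_axioms
          by (intro large_ideal.intro large_ideal_axioms.intro) simp_all
        \<comment> \<open>\<open>Xs k\<close> is the segment below \<open>u k\<close>, so the
          constant function \<open>u k\<close> is large.\<close>
        have "large (B m) (\<lambda>i. u k)" using J(2) by (simp add: large_def Xs_def)
        thus ?thesis by (rule large_imp_coverable)
      next
        case False
        have "coverable X 0"
          by (rule coverable_if_no_large_fam[OF large_X X_Un Xs_less]) (use False in blast)
        thus ?thesis by (rule exI)
      qed
    qed
  qed
qed

end

section \<open>Dense families and filtrations\<close>

text \<open>If some bound on \<open>h\<close> holds cofinally often, the points satisfying it form
  \<open>I\<close>. Otherwise choose \<open>u n\<close> above which \<open>h\<close> exceeds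
  \<open>n\<close>: these points are cofinal, and \<open>u m\<close> below \<open>v\<close> forces
  \<open>m < h v\<close>, so only finitely many lie below \<open>v\<close>.\<close>

lemma ex_cofinal_locally_bounded:
  fixes h :: "'a \<Rightarrow> nat"
  assumes "infinite X"
  obtains I where "I \<subseteq> X" "\<forall>x\<in>X. \<exists>v\<in>I. x \<in> underS |X| v"
    "\<forall>v\<in>I. \<exists>N. \<forall>u\<in>I \<inter> underS |X| v. h u \<le> N"
proof (cases "\<exists>n. \<forall>u\<in>X. \<exists>v\<in>X. u \<in> underS |X| v \<and> h v \<le> n")
  case True
  then obtain n where n: "\<forall>u\<in>X. \<exists>v\<in>X. u \<in> underS |X| v \<and> h v \<le> n" by (rule exE)
  show thesis
  proof (rule that)
    show "{v\<in>X. h v \<le> n} \<subseteq> X" by blast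
    show "\<forall>x\<in>X. \<exists>v\<in>{v\<in>X. h v \<le> n}. x \<in> underS |X| v" using n by blast
    show "\<forall>v\<in>{v\<in>X. h v \<le> n}. \<exists>N. \<forall>u\<in>{v\<in>X. h v \<le> n} \<inter> underS |X| v. h u \<le> N" by auto
  qed
next
  case False
  hence "\<forall>n. \<exists>u. u \<in> X \<and> (\<forall>v\<in>X. u \<in> underS |X| v \<longrightarrow> \<not> h v \<le> n)" by blast
  from choice[OF this] obtain u where
    u: "\<forall>n. u n \<in> X \<and> (\<forall>v\<in>X. u n \<in> underS |X| v \<longrightarrow> \<not> h v \<le> n)" by (rule exE)
  show thesis
  proof (rule that)
    show "range u \<subseteq> X" using u by auto
    show "\<forall>x\<in>X. \<exists>v\<in>range u. x \<in> underS |X| v"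
    proof
      fix x assume "x \<in> X"
      then obtain y where y: "y \<in> X" "x \<in> underS |X| y" using underS_card_of_unbounded[OF assms] by blast
      have "u (h y) \<notin> underS |X| y" using u y(1) by blast
      hence "y = u (h y) \<or> y \<in> underS |X| (u (h y))"
        using underS_card_of_total[of "u (h y)" X y] u y(1) by simp
      hence "x \<in> underS |X| (u (h y))" using y(2) underS_card_of_trans by metis
      thus "\<exists>v\<in>range u. x \<in> underS |X| v" by blast
    qed
    show "\<forall>v\<in>range u. \<exists>N. \<forall>w\<in>range u \<inter> underS |X| v. h w \<le> N"
    proof
      fix v assume "v \<in> range u"
      hence "v \<in> X" using u by auto
      hence "range u \<inter> underS |X| v \<subseteq> u ` {..<h v}" using u by (auto simp: not_le)
      hence "finite (h ` (range u \<inter> underS |X| v))" using finite_surj[of "{..<h v}"] by blast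
      thus "\<exists>N. \<forall>w\<in>range u \<inter> underS |X| v. h w \<le> N"
        unfolding finite_nat_set_iff_bounded_le by simp
    qed
  qed
qed

context beth_seq
begin

definition dense_fam :: "'a set \<Rightarrow> nat \<Rightarrow> 'a set set \<Rightarrow> bool" where
  "dense_fam V n \<P> \<longleftrightarrow> |\<P>| \<le>o |V| \<and> (\<forall>P\<in>\<P>. |B 0| \<le>o |P| ) \<and>
     (\<forall>A\<subseteq>V. |B n| \<le>o |A| \<longrightarrow> (\<exists>P\<in>\<P>. P \<subseteq> A))"

text \<open>The members of a cover smaller than \<open>B 0\<close> are dropped. A union of
  \<open>|B n|\<close> such members has size at most \<open>|B n|\<close>, so a set of size
  \<open>|B (Suc n)|\<close> needs a remaining one; hence the level \<open>Suc n\<close>.\<close>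

lemma ex_dense_fam: "\<exists>n \<P>. dense_fam V n \<P>"
proof -
  obtain n where "coverable V n" using ex_coverable[of V] by (rule exE)
  then obtain \<P> where P: "|\<P>| \<le>o |V|"
    "\<forall>A\<subseteq>V. small A \<longrightarrow> (\<exists>\<Q>\<subseteq>\<P>. |\<Q>| \<le>o |B n| \<and> A = \<Union>\<Q>)" unfolding coverable_def by (elim exE conjE)
  define \<P>' where "\<P>' = {P\<in>\<P>. |B 0| \<le>o |P|}"
  have "\<exists>P\<in>\<P>'. P \<subseteq> A" if A: "A \<subseteq> V" "|B (Suc n)| \<le>o |A|" for A
  proof (rule ccontr)
    assume not: "\<not> ?thesis"
    \<comment> \<open>Covers speak of small sets only, so \<open>A\<close> is first cut
      down.\<close>
    obtain A' where A': "A' \<subseteq> A" "|A'| =o |B (Suc n)|" by (rule ex_subset_card_of[OF A(2)])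
    have "small A'" by (rule small_ordLeq[OF ordIso_imp_ordLeq[OF A'(2)] small_B])
    with P(2) A'(1) A(1) obtain \<Q> where Q: "\<Q> \<subseteq> \<P>" "|\<Q>| \<le>o |B n|" "A' = \<Union>\<Q>" by (meson subset_trans)
    have "|Q| \<le>o |B n|" if "Q \<in> \<Q>" for Q
    proof -
      have "Q \<notin> \<P>'" using not A'(1) Q(3) that by blast
      hence "\<not> |B 0| \<le>o |Q|" using Q(1) that by (auto simp: \<P>'_def)
      hence "|Q| <o |B 0|" by (simp add: not_card_of_ordLeq_iff)
      thus ?thesis using ordLess_imp_ordLeq ordLeq_transitive B_mono[of 0 n] by blast
    qed
    hence "|\<Union>Q\<in>\<Q>. Q| \<le>o |B n|" by (intro card_of_UNION_ordLeq_infinite infinite_B Q(2)) blast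
    hence "|A'| \<le>o |B n|" using Q(3) by simp
    hence "|B (Suc n)| \<le>o |B n|" by (rule ordIso_ordLeq_trans[OF ordIso_symmetric[OF A'(2)]])
    thus False using B_less_Suc[of n] not_ordLess_ordLeq by blast
  qed
  moreover have "|\<P>'| \<le>o |V|" by (rule card_of_ordLeq_trans_subset[OF _ P(1)]) (auto simp: \<P>'_def)
  ultimately have "dense_fam V (Suc n) \<P>'" unfolding dense_fam_def by (auto simp: \<P>'_def)
  thus ?thesis by blast
qed

text \<open>The level depends only on the cardinality of the set, so the stages of a closure of
  constant size can share one level.\<close>

lemma dense_fam_cong:
  assumes "dense_fam V n \<P>" "|V| =o |V'|"
  shows "\<exists>\<P>'. dense_fam V' n \<P>'"
proof -
  obtain f where f: "bij_betw f V V'" using assms(2) card_of_ordIso by blast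
  define \<P>' where "\<P>' = (`) f ` {P\<in>\<P>. P \<subseteq> V}"
  have inj: "inj_on f P" if "P \<subseteq> V" for P using f that by (meson bij_betw_def inj_on_subset)
  have "|\<P>'| \<le>o |V'|" unfolding \<P>'_def
    by (intro card_of_image_ordLeq card_of_ordLeq_trans_subset[of "{P\<in>\<P>. P \<subseteq> V}" \<P>]
        ordLeq_ordIso_trans[OF _ assms(2)]) (use assms(1) in \<open>auto simp: dense_fam_def\<close>)
  moreover have "|B 0| \<le>o |P'|" if P': "P' \<in> \<P>'" for P'
  proof -
    obtain P where P: "P \<in> \<P>" "P \<subseteq> V" "P' = f ` P" using P' by (auto simp: \<P>'_def)
    have "|B 0| \<le>o |P|" using assms(1) P by (simp add: dense_fam_def)
    thus ?thesis unfolding P(3)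
      by (rule ordLeq_ordIso_trans[OF _ ordIso_symmetric[OF card_of_inj_image[OF inj[OF P(2)]]]])
  qed
  moreover have "\<exists>P'\<in>\<P>'. P' \<subseteq> A'" if A': "A' \<subseteq> V'" "|B n| \<le>o |A'|" for A'
  proof -
    define A where "A = V \<inter> f -` A'"
    have fA: "f ` A = A'" using f A'(1) unfolding A_def bij_betw_def by blast
    have AV: "A \<subseteq> V" by (auto simp: A_def)
    have "|A'| \<le>o |A|" unfolding fA[symmetric] by (rule card_of_image)
    hence "|B n| \<le>o |A|" by (rule ordLeq_transitive[OF A'(2)])
    then obtain P where "P \<in> \<P>" "P \<subseteq> A" using assms(1) AV unfolding dense_fam_def by blast
    thus ?thesis unfolding \<P>'_def fA[symmetric] using AV by blast
  qed
  ultimately show ?thesis unfolding dense_fam_def by (intro exI[of _ \<P>']) simp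
qed

end

section \<open>Closing off under the members of a sparse family\<close>

locale above_beth = beth_seq B for B :: "nat \<Rightarrow> 'a set" +
  fixes R :: "'a set"
  assumes B_leq_R: "|B n| \<le>o |R|"
begin

lemma infinite_R: "infinite R"
  using B_leq_R[of 0] infinite_B card_of_ordLeq_infinite by blast

lemma B_less_R: "|B n| <o |R|"
  by (rule ordLess_ordLeq_trans[OF B_less_Suc B_leq_R])

text \<open>Here \<open>R\<close> has size \<rho> and \<open>B 0\<close> size \<nu>. Counting the
  members above a set is a form of the intersection condition that survives the removal of points
  from the members.\<close>

definition sparse :: "'a set \<Rightarrow> 'a set set \<Rightarrow> bool" where
  "sparse V \<F> \<longleftrightarrow> \<F> \<subseteq> Pow V \<and> (\<forall>A\<in>\<F>. |A| =o |R| ) \<and>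
     (\<forall>S. |B 0| \<le>o |S| \<longrightarrow> |{A\<in>\<F>. S \<subseteq> A}| \<le>o |R| )"

lemma sparse_large: "sparse V \<F> \<Longrightarrow> A \<in> \<F> \<Longrightarrow> |B n| \<le>o |A|"
  using ordLeq_ordIso_trans[OF B_leq_R ordIso_symmetric] unfolding sparse_def by blast

lemma sparse_Union_le:
  assumes F: "sparse V \<F>" and K: "|R| \<le>o |K|" and \<P>: "|\<P>| \<le>o |K|" "\<And>P. P \<in> \<P> \<Longrightarrow> |B 0| \<le>o |P|"
  shows "|\<Union>{A\<in>\<F>. \<exists>P\<in>\<P>. P \<subseteq> A}| \<le>o |K|"
proof -
  have infK: "infinite K" using K infinite_R card_of_ordLeq_infinite by blast
  have "|\<Union>A\<in>{A\<in>\<F>. P \<subseteq> A}. A| \<le>o |K|" if P: "P \<in> \<P>" for P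
  proof (rule card_of_UNION_ordLeq_infinite[OF infK])
    show "|{A\<in>\<F>. P \<subseteq> A}| \<le>o |K|"
      by (rule ordLeq_transitive[OF _ K]) (use F \<P>(2)[OF P] in \<open>simp add: sparse_def\<close>)
    have "|A| \<le>o |K|" if "A \<in> \<F>" for A
      by (rule ordIso_ordLeq_trans[OF _ K]) (use F that in \<open>simp add: sparse_def\<close>)
    thus "\<forall>A\<in>{A\<in>\<F>. P \<subseteq> A}. |A| \<le>o |K|" by simp
  qed
  hence "|\<Union>P\<in>\<P>. \<Union>A\<in>{A\<in>\<F>. P \<subseteq> A}. A| \<le>o |K|"
    by (intro card_of_UNION_ordLeq_infinite infK \<P>(1)) blast
  moreover have "\<Union>{A\<in>\<F>. \<exists>P\<in>\<P>. P \<subseteq> A} = (\<Union>P\<in>\<P>. \<Union>A\<in>{A\<in>\<F>. P \<subseteq> A}. A)" by blast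
  ultimately show ?thesis by simp
qed

text \<open>At each of \<open>\<omega>\<close> stages, all members are added that contain a set of a
  dense family of that stage or a set coded in it by \<open>e\<close>. A member meeting the union in
  \<open>|B (Suc n)|\<close> points meets some stage in \<open>|B n|\<close> points, because a
  countable union of smaller parts has size at most \<open>|B n|\<close>.\<close>

lemma ex_closure:
  fixes e :: "'a set \<Rightarrow> 'a"
  assumes F: "sparse V \<F>" and KV: "K \<subseteq> V" and K: "|R| \<le>o |K|" and dense: "dense_fam K n \<D>"
    and e: "inj_on e \<P>" and P: "\<forall>P\<in>\<P>. |B 0| \<le>o |P|"
  shows "\<exists>K'. K \<subseteq> K' \<and> K' \<subseteq> V \<and> |K'| \<le>o |K| \<and>
    (\<forall>A\<in>\<F>. |B (Suc n)| \<le>o |A \<inter> K'| \<longrightarrow> A \<subseteq> K') \<and> (\<forall>P\<in>\<P>. \<forall>A\<in>\<F>. e P \<in> K' \<longrightarrow> P \<subseteq> A \<longrightarrow> A \<subseteq> K')"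
proof -
  have infK: "infinite K" using K infinite_R card_of_ordLeq_infinite by blast
  define D where "D H = (SOME \<D>. dense_fam H n \<D>)" for H
  have D: "dense_fam H n (D H)" if H: "|H| =o |K|" for H
    unfolding D_def by (rule someI_ex[OF dense_fam_cong[OF dense ordIso_symmetric[OF H]]])
  define S where "S H = D H \<union> {P\<in>\<P>. e P \<in> H}" for H
  define step where "step H = H \<union> \<Union>{A\<in>\<F>. \<exists>P\<in>S H. P \<subseteq> A}" for H
  have step: "K \<subseteq> step H \<and> step H \<subseteq> V \<and> |step H| =o |K|" if H: "K \<subseteq> H \<and> H \<subseteq> V \<and> |H| =o |K|" for H
  proof -
    have HK: "|H| =o |K|" using H by simp
    have "|D H| \<le>o |K|"
      by (rule ordLeq_ordIso_trans[OF _ HK]) (use D[OF HK] in \<open>simp add: dense_fam_def\<close>)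
    moreover have "|{P\<in>\<P>. e P \<in> H}| \<le>o |K|"
    proof (rule ordLeq_ordIso_trans[OF _ HK])
      have "inj_on e {P\<in>\<P>. e P \<in> H}" by (rule inj_on_subset[OF e]) blast
      moreover have "e ` {P\<in>\<P>. e P \<in> H} \<subseteq> H" by blast
      ultimately show "|{P\<in>\<P>. e P \<in> H}| \<le>o |H|" by (intro card_of_ordLeq[THEN iffD1] exI conjI)
    qed
    ultimately have "|S H| \<le>o |K|" unfolding S_def by (rule card_of_Un_ordLeq_infinite[OF infK])
    moreover have "|B 0| \<le>o |P|" if "P \<in> S H" for P
      using that P D[OF HK] unfolding S_def dense_fam_def by blast
    ultimately have "|\<Union>{A\<in>\<F>. \<exists>P\<in>S H. P \<subseteq> A}| \<le>o |K|" by (rule sparse_Union_le[OF F K])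
    hence "|step H| \<le>o |K|" unfolding step_def
      by (rule card_of_Un_ordLeq_infinite[OF infK ordIso_imp_ordLeq[OF HK]])
    moreover have "K \<subseteq> step H" using H by (auto simp: step_def)
    moreover from this have "|K| \<le>o |step H|" by (rule card_of_mono1)
    moreover have "step H \<subseteq> V" using H F unfolding step_def sparse_def by blast
    ultimately show ?thesis by (simp add: ordIso_iff_ordLeq)
  qed
  define Ks where "Ks j = (step ^^ j) K" for j
  have Ks_Suc: "Ks (Suc j) = step (Ks j)" for j by (simp add: Ks_def)
  have Ks: "K \<subseteq> Ks j \<and> Ks j \<subseteq> V \<and> |Ks j| =o |K|" for j
    by (induction j) (use KV step in \<open>auto simp: Ks_def card_of_refl\<close>)
  have closed: "A \<subseteq> Ks (Suc j)" if "A \<in> \<F>" "Q \<in> S (Ks j)" "Q \<subseteq> A" for A Q j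
    unfolding Ks_Suc step_def using that by blast
  define K' where "K' = (\<Union>j. Ks j)"
  have sub: "Ks j \<subseteq> K'" for j by (auto simp: K'_def)
  have "A \<subseteq> K'" if A: "A \<in> \<F>" "|B (Suc n)| \<le>o |A \<inter> K'|" for A
  proof -
    have "\<exists>j. |B n| \<le>o |A \<inter> Ks j|"
    proof (rule ccontr)
      assume "\<not> ?thesis"
      hence "|A \<inter> Ks j| \<le>o |B n|" for j
        using not_card_of_ordLeq_iff[of "B n" "A \<inter> Ks j"] ordLess_imp_ordLeq by blast
      hence "|\<Union>j. A \<inter> Ks j| \<le>o |B n|" by (intro card_of_UNION_nat_ordLeq infinite_B)
      moreover have "(\<Union>j. A \<inter> Ks j) = A \<inter> K'" by (auto simp: K'_def)
      ultimately have "|B (Suc n)| \<le>o |B n|" using A(2) ordLeq_transitive by metis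
      thus False using B_less_Suc[of n] not_ordLess_ordLeq by blast
    qed
    then obtain j where j: "|B n| \<le>o |A \<inter> Ks j|" by (rule exE)
    have "dense_fam (Ks j) n (D (Ks j))" using Ks by (intro D) simp
    then obtain Q where "Q \<in> D (Ks j)" "Q \<subseteq> A \<inter> Ks j" using j unfolding dense_fam_def by (meson Int_lower2)
    hence "A \<subseteq> Ks (Suc j)" by (intro closed[OF A(1)]) (auto simp: S_def)
    thus ?thesis using sub by (rule subset_trans)
  qed
  moreover have "A \<subseteq> K'" if A: "Q \<in> \<P>" "A \<in> \<F>" "e Q \<in> K'" "Q \<subseteq> A" for A Q
  proof -
    obtain j where "e Q \<in> Ks j" using A(3) by (auto simp: K'_def)
    hence "A \<subseteq> Ks (Suc j)" using A by (intro closed[of _ Q]) (auto simp: S_def)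
    thus ?thesis using sub by (rule subset_trans)
  qed
  moreover have "K \<subseteq> K'" using Ks[of 0] sub[of 0] by blast
  moreover have "K' \<subseteq> V" using Ks by (auto simp: K'_def)
  moreover have "|K'| \<le>o |K|" unfolding K'_def
    by (intro card_of_UNION_nat_ordLeq infK ordIso_imp_ordLeq) (use Ks in simp)
  ultimately show ?thesis by (intro exI[of _ K']) simp
qed

text \<open>By recursion along \<open>|V|\<close>, \<open>K v\<close> is a closed set containing the
  segment below \<open>v\<close> and all earlier \<open>K u\<close>. A member not inside
  \<open>K u\<close> meets it in fewer than \<open>|B (Suc (nn u))|\<close> points. The stages kept
  in \<open>I\<close> are such that the levels before each of them are bounded, so that the chain of
  traces has a union smaller than \<rho>.\<close>

lemma ex_filtration:
  assumes F: "sparse V \<F>" and V: "|R| <o |V|"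
  obtains I :: "'a set" and K :: "'a \<Rightarrow> 'a set" where
    "\<forall>v\<in>I. K v \<subseteq> V \<and> |K v| <o |V|"
    "\<forall>x\<in>V. \<exists>v\<in>I. x \<in> K v"
    "\<forall>A\<in>\<F>. \<exists>v\<in>I. A \<subseteq> K v" "I \<subseteq> V"
    "\<forall>v\<in>I. \<forall>A\<in>\<F>. (\<forall>u\<in>I \<inter> underS |V| v. \<not> A \<subseteq> K u) \<longrightarrow> |A \<inter> (\<Union>u\<in>I \<inter> underS |V| v. K u)| <o |R|"
proof -
  obtain R' where R': "R' \<subseteq> V" "|R'| =o |R|" by (rule ex_subset_card_of[OF ordLess_imp_ordLeq[OF V]])
  have infV: "infinite V" using card_of_ordLeq_infinite[OF ordLess_imp_ordLeq[OF V] infinite_R] .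
  let ?seg = "underS |V|"
  \<comment> \<open>A copy of \<open>R\<close> gives every stage size at least \<rho>, enough to
    absorb the members above a given set.\<close>
  define Y where "Y v = ?seg v \<union> R'" for v
  have YV: "Y v \<subseteq> V" for v unfolding Y_def using R'(1) underS_card_of_subset[of V v] by blast
  have RY: "|R| \<le>o |Y v|" for v
    by (rule ordIso_ordLeq_trans[OF ordIso_symmetric[OF R'(2)] card_of_mono1]) (simp add: Y_def)
  have infY: "infinite (Y v)" for v by (rule card_of_ordLeq_infinite[OF RY infinite_R])
  have Y_mono: "Y u \<subseteq> Y v" if "u \<in> ?seg v" for u v
    unfolding Y_def using underS_card_of_trans[OF _ that] by blast
  have Y_less: "|Y v| <o |V|" if "v \<in> V" for v unfolding Y_def
    by (rule card_of_Un_ordLess_infinite[OF infV underS_card_of_less[OF that] ordIso_ordLess_trans[OF R'(2) V]])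
  have "\<forall>v. \<exists>n. \<exists>\<D>. dense_fam (Y v) n \<D>" using ex_dense_fam by blast
  from choice[OF this] obtain nn where nn: "\<forall>v. \<exists>\<D>. dense_fam (Y v) (nn v) \<D>" by (rule exE)
  \<comment> \<open>Every member of \<open>\<F>\<close> contains a set \<open>P\<close> of this
    second dense family, on all of \<open>V\<close>, and is swallowed by any stage that contains the
    code \<open>e P\<close>.\<close>
  obtain n0 \<P> where \<P>: "dense_fam V n0 \<P>" using ex_dense_fam[of V] by blast
  hence "|\<P>| \<le>o |V|" by (simp add: dense_fam_def)
  then obtain e where e: "inj_on e \<P>" "e ` \<P> \<subseteq> V" unfolding card_of_ordLeq[symmetric] by (elim exE conjE)
  define Q where "Q K v Kv \<longleftrightarrow> Y v \<union> (\<Union>u\<in>?seg v. K u) \<subseteq> Kv \<and> Kv \<subseteq> V \<and> |Kv| \<le>o |Y v| \<and>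
    (\<forall>A\<in>\<F>. |B (Suc (nn v))| \<le>o |A \<inter> Kv| \<longrightarrow> A \<subseteq> Kv) \<and>
    (\<forall>P\<in>\<P>. \<forall>A\<in>\<F>. e P \<in> Kv \<longrightarrow> P \<subseteq> A \<longrightarrow> A \<subseteq> Kv)" for K :: "'a \<Rightarrow> 'a set" and v Kv
  have "\<exists>K. \<forall>v. Q K v (K v)"
  proof (rule dependent_wf_choice[OF wf_card_of[of V]])
    fix f g :: "'a \<Rightarrow> 'a set" and v Kv assume "\<And>z. (z, v) \<in> |V| - Id \<Longrightarrow> f z = g z"
    hence "(\<Union>u\<in>?seg v. f u) = (\<Union>u\<in>?seg v. g u)" unfolding underS_iff[symmetric] by simp
    thus "Q f v Kv = Q g v Kv" by (simp add: Q_def)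
  next
    fix v and f :: "'a \<Rightarrow> 'a set" assume IH: "\<And>u. (u, v) \<in> |V| - Id \<Longrightarrow> Q f u (f u)"
    define U where "U = Y v \<union> (\<Union>u\<in>?seg v. f u)"
    have fu: "|f u| \<le>o |Y v|" "f u \<subseteq> V" if "u \<in> ?seg v" for u
    proof -
      have "Q f u (f u)" using that by (intro IH) (simp add: underS_iff)
      hence fu: "|f u| \<le>o |Y u|" "f u \<subseteq> V" by (simp_all add: Q_def)
      show "|f u| \<le>o |Y v|" by (rule ordLeq_transitive[OF fu(1) card_of_mono1[OF Y_mono[OF that]]])
      show "f u \<subseteq> V" by (rule fu)
    qed
    have "|?seg v| \<le>o |Y v|" by (rule card_of_mono1) (simp add: Y_def)
    hence "|\<Union>u\<in>?seg v. f u| \<le>o |Y v|" by (intro card_of_UNION_ordLeq_infinite[OF infY]) (use fu in auto)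
    hence "|U| \<le>o |Y v|" unfolding U_def
      by (rule card_of_Un_ordLeq_infinite[OF infY ordIso_imp_ordLeq[OF card_of_refl]])
    moreover have YU: "|Y v| \<le>o |U|" by (rule card_of_mono1) (simp add: U_def)
    ultimately have YU': "|Y v| =o |U|" by (simp add: ordIso_iff_ordLeq)
    from nn obtain \<D> where "dense_fam (Y v) (nn v) \<D>" by blast
    from dense_fam_cong[OF this YU'] obtain \<D>' where D: "dense_fam U (nn v) \<D>'" by (rule exE)
    have UV: "U \<subseteq> V" unfolding U_def using YV fu(2) by blast
    have "\<forall>P\<in>\<P>. |B 0| \<le>o |P|" using \<P> by (simp add: dense_fam_def)
    from ex_closure[OF F UV ordLeq_transitive[OF RY YU] D e(1) this] obtain Kv where Kv: "U \<subseteq> Kv" "Kv \<subseteq> V" "|Kv| \<le>o |U|"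
      "\<forall>A\<in>\<F>. |B (Suc (nn v))| \<le>o |A \<inter> Kv| \<longrightarrow> A \<subseteq> Kv"
      "\<forall>P\<in>\<P>. \<forall>A\<in>\<F>. e P \<in> Kv \<longrightarrow> P \<subseteq> A \<longrightarrow> A \<subseteq> Kv"
      by (elim exE conjE)
    have "|Kv| \<le>o |Y v|" by (rule ordLeq_ordIso_trans[OF Kv(3) ordIso_symmetric[OF YU']])
    thus "\<exists>Kv. Q f v Kv" unfolding Q_def using Kv by (intro exI[of _ Kv] conjI) (simp_all add: U_def)
  qed
  then obtain K where K: "\<forall>v. Q K v (K v)" by (rule exE)
  have KY: "Y v \<subseteq> K v" and KV: "K v \<subseteq> V" and K_le: "|K v| \<le>o |Y v|" for v
    using K unfolding Q_def by blast+
  have K_mono: "K u \<subseteq> K v" if "u \<in> ?seg v" for u v using K that unfolding Q_def by blast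
  have K_closed: "A \<subseteq> K v" if "A \<in> \<F>" "|B (Suc (nn v))| \<le>o |A \<inter> K v|" for A v
    using K that unfolding Q_def by simp
  obtain I where I: "I \<subseteq> V" "\<forall>x\<in>V. \<exists>v\<in>I. x \<in> ?seg v" "\<forall>v\<in>I. \<exists>N. \<forall>u\<in>I \<inter> ?seg v. nn u \<le> N"
    by (rule ex_cofinal_locally_bounded[OF infV])
  have xK: "\<exists>v\<in>I. x \<in> K v" if "x \<in> V" for x
    using I(2) that KY unfolding Y_def by blast
  show thesis
  proof (rule that)
    show "\<forall>v\<in>I. K v \<subseteq> V \<and> |K v| <o |V|"
      using KV ordLeq_ordLess_trans[OF K_le Y_less] I(1) by blast
    show "\<forall>x\<in>V. \<exists>v\<in>I. x \<in> K v" using xK by blast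
    show "I \<subseteq> V" by (rule I)
    show "\<forall>A\<in>\<F>. \<exists>v\<in>I. A \<subseteq> K v"
    proof
      fix A assume A: "A \<in> \<F>"
      hence "A \<subseteq> V" using F by (auto simp: sparse_def)
      then obtain P where P: "P \<in> \<P>" "P \<subseteq> A"
        using \<P> sparse_large[OF F A] unfolding dense_fam_def by blast
      have "e P \<in> V" using e(2) P(1) by blast
      then obtain v where v: "v \<in> I" "e P \<in> K v" using xK by blast
      have "A \<subseteq> K v" using K P A v(2) unfolding Q_def by blast
      thus "\<exists>v\<in>I. A \<subseteq> K v" using v(1) by blast
    qed
    show "\<forall>v\<in>I. \<forall>A\<in>\<F>. (\<forall>u\<in>I \<inter> ?seg v. \<not> A \<subseteq> K u) \<longrightarrow> |A \<inter> (\<Union>u\<in>I \<inter> ?seg v. K u)| <o |R|"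
    proof (intro ballI impI)
      fix v A assume v: "v \<in> I" and A: "A \<in> \<F>" and not: "\<forall>u\<in>I \<inter> ?seg v. \<not> A \<subseteq> K u"
      from I(3) v obtain N where N: "\<forall>u\<in>I \<inter> ?seg v. nn u \<le> N" by blast
      have "|\<Union>u\<in>I \<inter> ?seg v. A \<inter> K u| \<le>o |B (Suc N)|"
      proof (rule chain_Union_ordLeq[OF infinite_B])
        fix u w assume uw: "u \<in> I \<inter> ?seg v" "w \<in> I \<inter> ?seg v"
        hence "u = w \<or> u \<in> ?seg w \<or> w \<in> ?seg u" using underS_card_of_total[of u V w] I(1) by blast
        thus "A \<inter> K u \<subseteq> A \<inter> K w \<or> A \<inter> K w \<subseteq> A \<inter> K u" using K_mono by blast
      next
        fix u assume u: "u \<in> I \<inter> ?seg v"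
        have "\<not> |B (Suc (nn u))| \<le>o |A \<inter> K u|" using K_closed[OF A] not u by blast
        hence "|A \<inter> K u| <o |B (Suc (nn u))|" by (simp add: not_card_of_ordLeq_iff)
        moreover have "|B (Suc (nn u))| \<le>o |B (Suc N)|" using N u by (intro B_mono) simp
        ultimately show "|A \<inter> K u| <o |B (Suc N)|" by (rule ordLess_ordLeq_trans)
      qed
      moreover have "(\<Union>u\<in>I \<inter> ?seg v. A \<inter> K u) = A \<inter> (\<Union>u\<in>I \<inter> ?seg v. K u)" by blast
      ultimately have "|A \<inter> (\<Union>u\<in>I \<inter> ?seg v. K u)| \<le>o |B (Suc N)|" by simp
      thus "|A \<inter> (\<Union>u\<in>I \<inter> ?seg v. K u)| <o |R|" by (rule ordLeq_ordLess_trans[OF _ B_less_R])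
    qed
  qed
qed

end

section \<open>Conflict-free colorings\<close>

context above_beth
begin

text \<open>Removing fewer than \<rho> points keeps the size \<rho>, and any set inside
  \<open>A - U\<close> is inside \<open>A\<close>, so no set gets more members above it.\<close>

lemma sparse_subset_Diff:
  assumes F: "sparse V \<F>" and G: "\<G> \<subseteq> \<F>" and D: "\<And>A. A \<in> \<G> \<Longrightarrow> A - U \<subseteq> D"
    and U: "\<And>A. A \<in> \<G> \<Longrightarrow> |A \<inter> U| <o |R|"
  shows "sparse D ((\<lambda>A. A - U) ` \<G>)"
  unfolding sparse_def
proof (intro conjI allI impI ballI)
  show "(\<lambda>A. A - U) ` \<G> \<subseteq> Pow D" using D by blast
next
  fix E assume "E \<in> (\<lambda>A. A - U) ` \<G>"
  then obtain A where A: "A \<in> \<G>" "E = A - U" by blast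
  have AR: "|A| =o |R|" using F G A(1) by (auto simp: sparse_def)
  have "infinite A" using infinite_R card_of_ordIso_finite[OF AR] by simp
  moreover have "|A \<inter> U| <o |A|" by (rule ordLess_ordIso_trans[OF U[OF A(1)] ordIso_symmetric[OF AR]])
  ultimately have "|A - U| =o |A|" by (rule card_of_Diff_ordIso)
  thus "|E| =o |R|" unfolding A(2) using AR by (rule ordIso_transitive)
next
  fix S :: "'a set" assume S: "|B 0| \<le>o |S|"
  have "{E\<in>(\<lambda>A. A - U) ` \<G>. S \<subseteq> E} \<subseteq> (\<lambda>A. A - U) ` {A\<in>\<F>. S \<subseteq> A}" using G by blast
  moreover have "|(\<lambda>A. A - U) ` {A\<in>\<F>. S \<subseteq> A}| \<le>o |R|"
    by (rule card_of_image_ordLeq) (use F S in \<open>simp add: sparse_def\<close>)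
  ultimately show "|{E\<in>(\<lambda>A. A - U) ` \<G>. S \<subseteq> E}| \<le>o |R|" by (rule card_of_ordLeq_trans_subset)
qed

text \<open>Each member contains one of at most \<rho> sets of a dense family, and each of these
  lies in at most \<rho> members.\<close>

lemma sparse_card_le:
  assumes F: "sparse V \<F>" and V: "|V| \<le>o |R|" shows "|\<F>| \<le>o |R|"
proof -
  obtain n \<P> where \<P>: "dense_fam V n \<P>" using ex_dense_fam[of V] by blast
  have "\<F> \<subseteq> (\<Union>P\<in>\<P>. {A\<in>\<F>. P \<subseteq> A})"
  proof
    fix A assume A: "A \<in> \<F>"
    hence "A \<subseteq> V" using F by (auto simp: sparse_def)
    then obtain P where "P \<in> \<P>" "P \<subseteq> A"
      using \<P> sparse_large[OF F A] unfolding dense_fam_def by blast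
    thus "A \<in> (\<Union>P\<in>\<P>. {A\<in>\<F>. P \<subseteq> A})" using A by blast
  qed
  moreover have "|\<Union>P\<in>\<P>. {A\<in>\<F>. P \<subseteq> A}| \<le>o |R|"
  proof (rule card_of_UNION_ordLeq_infinite[OF infinite_R])
    show "|\<P>| \<le>o |R|" by (rule ordLeq_transitive[OF _ V]) (use \<P> in \<open>simp add: dense_fam_def\<close>)
    show "\<forall>P\<in>\<P>. |{A\<in>\<F>. P \<subseteq> A}| \<le>o |R|" using \<P> F by (simp add: dense_fam_def sparse_def)
  qed
  ultimately show ?thesis by (rule card_of_ordLeq_trans_subset)
qed

text \<open>The set \<open>Z A\<close> is there for the induction on \<open>|V|\<close>: it holds the colors that the points of \<open>A\<close>
  have received at earlier stages.\<close>

definition colorable :: "'a set \<Rightarrow> 'a set set \<Rightarrow> ('a \<Rightarrow> 'c set) \<Rightarrow> ('a set \<Rightarrow> 'c set) \<Rightarrow> bool" where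
  "colorable V \<F> L Z \<longleftrightarrow> (\<exists>c. (\<forall>v\<in>V. c v \<in> L v) \<and>
     (\<forall>A\<in>\<F>. \<exists>x\<in>A. c x \<notin> Z A \<and> (\<forall>y\<in>A - {x}. c x \<noteq> c y)))"

text \<open>With at most \<rho> members, the forbidden colors number at most \<rho> in all. After
  deleting them from every list, an injective choice remains possible.\<close>

lemma colorable_base:
  fixes L :: "'a \<Rightarrow> 'c set"
  assumes F: "sparse V \<F>" and V: "|V| \<le>o |R|"
    and L: "\<forall>v\<in>V. |R| <o |L v|" and Z: "\<forall>A\<in>\<F>. |Z A| \<le>o |R|"
  shows "colorable V \<F> L Z"
proof -
  define Zs where "Zs = (\<Union>A\<in>\<F>. Z A)"
  have Zs: "|Zs| \<le>o |R|" unfolding Zs_def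
    by (rule card_of_UNION_ordLeq_infinite[OF infinite_R sparse_card_le[OF F V] Z])
  have "|V| \<le>o |L v - Zs|" if v: "v \<in> V" for v
  proof (rule ccontr)
    assume "\<not> ?thesis"
    hence "|L v - Zs| \<le>o |V|"
      using not_card_of_ordLeq_iff[of V "L v - Zs"] ordLess_imp_ordLeq by blast
    hence "|L v - Zs| \<le>o |R|" using V by (rule ordLeq_transitive)
    hence "|(L v - Zs) \<union> Zs| \<le>o |R|" by (rule card_of_Un_ordLeq_infinite[OF infinite_R _ Zs])
    hence "|L v| \<le>o |R|" by (rule card_of_ordLeq_trans_subset[rotated]) blast
    thus False using L v not_card_of_ordLeq_iff[of "L v" R] by simp
  qed
  then obtain c where c: "inj_on c V" "\<forall>v\<in>V. c v \<in> L v - Zs"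
    using injective_choice[of V "\<lambda>v. L v - Zs"] by blast
  have "\<exists>x\<in>A. c x \<notin> Z A \<and> (\<forall>y\<in>A - {x}. c x \<noteq> c y)" if A: "A \<in> \<F>" for A
  proof -
    have AV: "A \<subseteq> V" using F A by (auto simp: sparse_def)
    have "infinite A" using card_of_ordLeq_infinite[OF sparse_large[OF F A] infinite_B0] .
    then obtain x where x: "x \<in> A" by (metis finite.emptyI ex_in_conv)
    have "c x \<notin> Z A" using c(2) x AV A unfolding Zs_def by blast
    moreover have "\<forall>y\<in>A - {x}. c x \<noteq> c y" using c(1) x AV by (auto dest: inj_onD)
    ultimately show ?thesis using x by blast
  qed
  thus ?thesis using c(2) unfolding colorable_def by (intro exI[of _ c]) simp
qed

text \<open>A member is taken care of at the first stage of the filtration that contains it. Fewer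
  than \<rho> of its points are colored before; their colors join the forbidden ones, and the
  induction hypothesis colors the new points.\<close>

lemma colorable_step:
  fixes L :: "'a \<Rightarrow> 'c set"
  assumes IH: "\<And>V' \<F>' Z. |V'| <o |V| \<Longrightarrow> V' \<subseteq> V \<Longrightarrow> sparse V' \<F>' \<Longrightarrow>
      \<forall>A\<in>\<F>'. |Z A| \<le>o |R| \<Longrightarrow> colorable V' \<F>' L Z"
    and F: "sparse V \<F>" and V: "|R| <o |V|" and Z: "\<forall>A\<in>\<F>. |Z A| \<le>o |R|"
  shows "colorable V \<F> L Z"
proof -
  obtain I and K :: "'a \<Rightarrow> 'a set" where K: "\<forall>v\<in>I. K v \<subseteq> V \<and> |K v| <o |V|"
    and cov: "\<forall>x\<in>V. \<exists>v\<in>I. x \<in> K v" and FK: "\<forall>A\<in>\<F>. \<exists>v\<in>I. A \<subseteq> K v" and IV: "I \<subseteq> V"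
    and small_trace: "\<forall>v\<in>I. \<forall>A\<in>\<F>. (\<forall>u\<in>I \<inter> underS |V| v. \<not> A \<subseteq> K u) \<longrightarrow>
      |A \<inter> (\<Union>u\<in>I \<inter> underS |V| v. K u)| <o |R|"
    by (rule ex_filtration[OF F V])
  let ?seg = "underS |V|"
  have least: "\<exists>v\<in>I. P v \<and> (\<forall>u\<in>I \<inter> ?seg v. \<not> P u)" if ex: "\<exists>v\<in>I. P v" for P
  proof -
    obtain v0 where v0: "v0 \<in> {v\<in>I. P v}" using ex by blast
    show ?thesis
    proof (rule wfE_min[OF wf_card_of[of V] v0])
      fix v assume v: "v \<in> {v\<in>I. P v}" and m: "\<And>u. (u, v) \<in> |V| - Id \<Longrightarrow> u \<notin> {v\<in>I. P v}"
      have "\<not> P u" if "u \<in> I \<inter> ?seg v" for u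
        using m[of u] that underS_iff[of u "|V|" v] by simp
      hence "\<forall>u\<in>I \<inter> ?seg v. \<not> P u" by (rule ballI)
      thus ?thesis using v by blast
    qed
  qed
  define U where "U v = (\<Union>u\<in>I \<inter> ?seg v. K u)" for v
  \<comment> \<open>\<open>idx x\<close> is the first stage containing \<open>x\<close>, the one at
    which \<open>x\<close> is colored.\<close>
  define idx where "idx x = (SOME v. v \<in> I \<and> x \<in> K v \<and> (\<forall>u\<in>I \<inter> ?seg v. x \<notin> K u))" for x
  have idx: "idx x \<in> I \<and> x \<in> K (idx x) \<and> (\<forall>u\<in>I \<inter> ?seg (idx x). x \<notin> K u)" if x: "v \<in> I" "x \<in> K v" for x v
  proof -
    have "\<exists>v\<in>I. x \<in> K v" using x by blast
    from least[OF this] have "\<exists>v. v \<in> I \<and> x \<in> K v \<and> (\<forall>u\<in>I \<inter> ?seg v. x \<notin> K u)" by blast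
    thus ?thesis unfolding idx_def by (rule someI_ex)
  qed
  have idx_le: "idx x = v \<or> idx x \<in> ?seg v" if x: "v \<in> I" "x \<in> K v" for x v
  proof -
    have i: "idx x \<in> I" "v \<notin> ?seg (idx x)" using idx[OF x] x by blast+
    thus ?thesis using underS_card_of_total[of v V "idx x"] x(1) IV by blast
  qed
  have idx_U: "idx x \<in> ?seg v" if x: "x \<in> U v" for x v
  proof -
    obtain u where u: "u \<in> I" "u \<in> ?seg v" "x \<in> K u" using x unfolding U_def by blast
    from idx_le[OF u(1,3)] show ?thesis using u(2) underS_card_of_trans by metis
  qed
  have idx_D: "idx x = v" if x: "v \<in> I" "x \<in> K v - U v" for x v
  proof -
    have xK: "x \<in> K v" using x by blast
    have "idx x \<notin> ?seg v" using idx[OF x(1) xK] x(2) unfolding U_def by blast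
    thus ?thesis using idx_le[OF x(1) xK] by blast
  qed
  define Fv where "Fv v = {A\<in>\<F>. A \<subseteq> K v \<and> (\<forall>u\<in>I \<inter> ?seg v. \<not> A \<subseteq> K u)}" for v
  have trace: "|A \<inter> U v| <o |R|" if "v \<in> I" "A \<in> Fv v" for v A
    using small_trace that unfolding Fv_def U_def by blast
  \<comment> \<open>\<open>d\<close> is the coloring made at stage \<open>v\<close>. The function
    \<open>f\<close> enters only through points of \<open>U v\<close>, whose stages precede
    \<open>v\<close>, as the recursion demands.\<close>
  define Q where "Q f v d \<longleftrightarrow> (v \<in> I \<longrightarrow> (\<forall>x\<in>K v - U v. d x \<in> L x) \<and>
    (\<forall>A\<in>Fv v. \<exists>x\<in>A - U v. d x \<notin> Z A \<and> (\<forall>y\<in>A \<inter> U v. d x \<noteq> f (idx y) y) \<and>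
       (\<forall>y\<in>A - U v - {x}. d x \<noteq> d y)))" for f :: "'a \<Rightarrow> 'a \<Rightarrow> 'c" and v d
  have "\<exists>f. \<forall>v. Q f v (f v)"
  proof (rule dependent_wf_choice[OF wf_card_of[of V]])
    fix f g :: "'a \<Rightarrow> 'a \<Rightarrow> 'c" and v and d :: "'a \<Rightarrow> 'c" assume "\<And>z. (z, v) \<in> |V| - Id \<Longrightarrow> f z = g z"
    hence "f (idx y) = g (idx y)" if "y \<in> U v" for y using idx_U[OF that] unfolding underS_iff by blast
    hence "(\<forall>y\<in>A \<inter> U v. d x \<noteq> f (idx y) y) \<longleftrightarrow> (\<forall>y\<in>A \<inter> U v. d x \<noteq> g (idx y) y)" for A x by auto
    thus "Q f v d = Q g v d" by (simp only: Q_def)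
  next
    fix v and f :: "'a \<Rightarrow> 'a \<Rightarrow> 'c"
    show "\<exists>d. Q f v d"
    proof (cases "v \<in> I")
      case False
      thus ?thesis by (simp add: Q_def)
    next
      case v: True
      let ?G = "(\<lambda>A. A - U v) ` Fv v"
      \<comment> \<open>Several members may leave the same new part \<open>E\<close>. They all
        contain \<open>E\<close>, which has size \<rho>, so there are at most \<rho> of them and
        their forbidden colors can be merged.\<close>
      define Z' where "Z' E = (\<Union>A\<in>{A\<in>Fv v. A - U v = E}. Z A \<union> (\<lambda>y. f (idx y) y) ` (A \<inter> U v))" for E
      have sG: "sparse (K v - U v) ?G"
        by (rule sparse_subset_Diff[OF F]) (use trace[OF v] in \<open>auto simp: Fv_def\<close>)
      have Z': "\<forall>E\<in>?G. |Z' E| \<le>o |R|"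
      proof
        fix E assume E: "E \<in> ?G"
        have "|{A\<in>\<F>. E \<subseteq> A}| \<le>o |R|"
          using F sparse_large[OF sG E, of 0] unfolding sparse_def by simp
        hence "|{A\<in>Fv v. A - U v = E}| \<le>o |R|"
          by (rule card_of_ordLeq_trans_subset[rotated]) (auto simp: Fv_def)
        moreover have "|Z A \<union> (\<lambda>y. f (idx y) y) ` (A \<inter> U v)| \<le>o |R|" if "A \<in> Fv v" for A
        proof (rule card_of_Un_ordLeq_infinite[OF infinite_R])
          show "|Z A| \<le>o |R|" using Z that by (simp add: Fv_def)
          show "|(\<lambda>y. f (idx y) y) ` (A \<inter> U v)| \<le>o |R|"
            by (rule card_of_image_ordLeq[OF ordLess_imp_ordLeq[OF trace[OF v that]]])
        qed
        ultimately show "|Z' E| \<le>o |R|" unfolding Z'_def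
          by (intro card_of_UNION_ordLeq_infinite[OF infinite_R]) simp_all
      qed
      have "|K v - U v| <o |V|"
        by (rule ordLeq_ordLess_trans[OF card_of_mono1[OF Diff_subset]]) (use K v in simp)
      moreover have "K v - U v \<subseteq> V" using K v by blast
      ultimately have "colorable (K v - U v) ?G L Z'" using sG Z' by (rule IH)
      then obtain d where d: "\<forall>x\<in>K v - U v. d x \<in> L x"
        "\<forall>E\<in>?G. \<exists>x\<in>E. d x \<notin> Z' E \<and> (\<forall>y\<in>E - {x}. d x \<noteq> d y)"
        unfolding colorable_def by (elim exE conjE)
      have "\<exists>x\<in>A - U v. d x \<notin> Z A \<and> (\<forall>y\<in>A \<inter> U v. d x \<noteq> f (idx y) y) \<and> (\<forall>y\<in>A - U v - {x}. d x \<noteq> d y)"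
        if A: "A \<in> Fv v" for A
      proof -
        from d(2) A obtain x where x: "x \<in> A - U v" "d x \<notin> Z' (A - U v)" "\<forall>y\<in>A - U v - {x}. d x \<noteq> d y" by blast
        have "Z A \<union> (\<lambda>y. f (idx y) y) ` (A \<inter> U v) \<subseteq> Z' (A - U v)" unfolding Z'_def using A by blast
        hence "d x \<notin> Z A" "d x \<notin> (\<lambda>y. f (idx y) y) ` (A \<inter> U v)" using x(2) by blast+
        thus ?thesis using x(1,3) by blast
      qed
      hence "Q f v d" unfolding Q_def using d(1) by simp
      thus ?thesis by (rule exI[of _ d])
    qed
  qed
  then obtain f where f: "\<forall>v. Q f v (f v)" by (rule exE)
  define c where "c x = f (idx x) x" for x
  have "c x \<in> L x" if "x \<in> V" for x
  proof -
    have "\<exists>v\<in>I. x \<in> K v" by (rule bspec[OF cov that])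
    then obtain v where v: "v \<in> I" "x \<in> K v" by (elim bexE)
    have "x \<in> K (idx x) - U (idx x)" "idx x \<in> I" using idx[OF v] by (simp_all add: U_def)
    moreover have "Q f (idx x) (f (idx x))" using f by (rule spec)
    ultimately show ?thesis unfolding Q_def c_def by simp
  qed
  moreover have "\<exists>x\<in>A. c x \<notin> Z A \<and> (\<forall>y\<in>A - {x}. c x \<noteq> c y)" if A: "A \<in> \<F>" for A
  proof -
    have "\<exists>v\<in>I. A \<subseteq> K v" using FK A by blast
    from least[OF this] obtain v where v: "v \<in> I" "A \<in> Fv v" using A unfolding Fv_def by blast
    have AK: "A \<subseteq> K v" using v(2) by (simp add: Fv_def)
    have "\<exists>x\<in>A - U v. f v x \<notin> Z A \<and> (\<forall>y\<in>A \<inter> U v. f v x \<noteq> f (idx y) y) \<and>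
       (\<forall>y\<in>A - U v - {x}. f v x \<noteq> f v y)" using spec[OF f, of v] v unfolding Q_def by simp
    then obtain x where x: "x \<in> A - U v" "f v x \<notin> Z A" "\<forall>y\<in>A \<inter> U v. f v x \<noteq> f (idx y) y"
       "\<forall>y\<in>A - U v - {x}. f v x \<noteq> f v y" by blast
    have cD: "c y = f v y" if "y \<in> A - U v" for y
      unfolding c_def using idx_D[OF v(1)] that AK by blast
    have "c x \<noteq> c y" if y: "y \<in> A - {x}" for y
    proof (cases "y \<in> U v")
      case True
      have "f v x \<noteq> f (idx y) y" using x(3) y True by blast
      thus ?thesis unfolding cD[OF x(1)] by (simp add: c_def)
    next
      case False
      have "y \<in> A - U v" using y False by blast
      thus ?thesis using cD[OF x(1)] cD[of y] x(4) y by simp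
    qed
    moreover have "c x \<notin> Z A" using x(2) cD[OF x(1)] by simp
    ultimately show ?thesis using x(1) by blast
  qed
  ultimately show ?thesis unfolding colorable_def by (intro exI[of _ c]) simp
qed

theorem sparse_colorable:
  fixes L :: "'a \<Rightarrow> 'c set"
  assumes "sparse V \<F>" "\<forall>v\<in>V. |R| <o |L v|" "\<forall>A\<in>\<F>. |Z A| \<le>o |R|"
  shows "colorable V \<F> L Z"
  using assms
proof (induction V arbitrary: \<F> Z rule: wf_induct_rule[OF wf_inv_image[OF wf_ordLess, of card_of]])
  case (1 V)
  show ?case
  proof (cases "|V| \<le>o |R|")
    case True
    thus ?thesis using 1(2-4) by (intro colorable_base)
  next
    case False
    hence "|R| <o |V|" by (simp add: not_card_of_ordLeq_iff)
    thus ?thesis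
    proof (rule colorable_step[OF _ 1(2) _ 1(4), rotated])
      fix V' \<F>' Z assume V': "|V'| <o |V|" "V' \<subseteq> V" "sparse V' \<F>'" "\<forall>A\<in>\<F>'. |Z A :: 'c set| \<le>o |R|"
      show "colorable V' \<F>' L Z"
        by (rule 1(1)[OF _ V'(3) _ V'(4)]) (use V'(1,2) 1(3) in \<open>auto simp: inv_image_def\<close>)
    qed
  qed
qed

end

section \<open>Realizing the beth cardinals by subsets of one member of the family\<close>

lemma is_beth_Card_order: "is_beth \<nu> n \<gamma> \<Longrightarrow> Card_order \<gamma>"
  by (cases n) auto

text \<open>Cardinals for \<open>n\<close> and \<open>Suc n\<close> are chosen independently; this
  identifies the predecessor hidden in the second with the first.\<close>

lemma is_beth_unique:
  fixes \<gamma> \<gamma>' :: "'b rel"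
  shows "is_beth \<nu> n \<gamma> \<Longrightarrow> is_beth \<nu> n \<gamma>' \<Longrightarrow> \<gamma> =o \<gamma>'"
proof (induction n arbitrary: \<gamma> \<gamma>')
  case 0
  hence "\<gamma> =o \<nu>" "\<gamma>' =o \<nu>" by simp_all
  thus ?case by (rule ordIso_transitive[OF _ ordIso_symmetric])
next
  case (Suc n)
  then obtain \<delta> \<delta>' :: "'b rel" where d: "is_beth \<nu> n \<delta>" "\<gamma> =o ctwo ^c \<delta>" "is_beth \<nu> n \<delta>'" "\<gamma>' =o ctwo ^c \<delta>'" by auto
  have "\<delta> =o \<delta>'" by (rule Suc.IH[OF d(1,3)])
  hence "ctwo ^c \<delta> =o ctwo ^c \<delta>'"
    by (rule cexp_cong2[OF _ Card_order_ctwo is_beth_Card_order[OF d(1)]]) 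
  hence "ctwo ^c \<delta> =o \<gamma>'" by (rule ordIso_transitive[OF _ ordIso_symmetric[OF d(4)]])
  with d(2) show ?case by (rule ordIso_transitive)
qed

theorem corollary4p11:
  fixes \<nu> :: "'n rel" and \<beta> :: "'b rel" and \<rho> :: "'r rel" and \<F> :: "'a set set"
  assumes "Card_order \<nu>" and "infinite (Field \<nu>)"
    and "is_beth_omega \<nu> \<beta>"
    and "Card_order \<rho>" and "\<beta> \<le>o \<rho>"
    and "uniform_family \<rho> \<F>"
    and "C_condition (cardSuc \<rho>) \<nu> \<F>"
  shows "list_cf_number TYPE('c) \<F> \<le>o cardSuc \<rho>"
proof (cases "\<F> = {}")
  case True
  have "list_conflict_free TYPE('c) \<F> (cardSuc \<rho>)"
    unfolding list_conflict_free_def conflict_free_def True by simp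
  thus ?thesis using True cardSuc_Card_order[OF assms(4)] by (intro list_cf_number_least) simp_all
next
  case False
  \<comment> \<open>A member serves as the set of size \<rho>. The \<open>B n\<close> are chosen
    inside it, so that all auxiliary sets live in the type of the points.\<close>
  then obtain R where RF: "R \<in> \<F>" by blast
  have F_rho: "|A| =o \<rho>" if "A \<in> \<F>" for A using assms(6) that by (simp add: uniform_family_def)
  have R: "|R| =o \<rho>" by (rule F_rho[OF RF])
  have "\<forall>n. \<exists>\<gamma> :: 'b rel. is_beth \<nu> n \<gamma> \<and> \<gamma> \<le>o \<beta>" using assms(3) by (simp add: is_beth_omega_def)
  from choice[OF this] obtain \<gamma> :: "nat \<Rightarrow> 'b rel" where \<gamma>: "\<forall>n. is_beth \<nu> n (\<gamma> n) \<and> \<gamma> n \<le>o \<beta>" by (rule exE)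
  have "\<forall>n. \<exists>B. B \<subseteq> R \<and> |B| =o \<gamma> n"
  proof
    fix n
    have "\<gamma> n \<le>o \<beta>" using \<gamma> by simp
    hence "\<gamma> n \<le>o \<rho>" using assms(5) by (rule ordLeq_transitive)
    hence "\<gamma> n \<le>o |R|" by (rule ordLeq_ordIso_trans[OF _ ordIso_symmetric[OF R]])
    moreover have "is_beth \<nu> n (\<gamma> n)" using \<gamma> by simp
    hence "Card_order (\<gamma> n)" by (rule is_beth_Card_order)
    ultimately show "\<exists>B. B \<subseteq> R \<and> |B| =o \<gamma> n" by (intro Card_order_subset)
  qed
  from choice[OF this] obtain B where B: "\<forall>n. B n \<subseteq> R \<and> |B n| =o \<gamma> n" by (rule exE)
  have "\<gamma> 0 =o \<nu>" using \<gamma>[rule_format, of 0] by simp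
  moreover have "|B 0| =o \<gamma> 0" using B by simp
  ultimately have B0: "|B 0| =o \<nu>" by (rule ordIso_transitive[rotated])
  interpret above_beth B R
  proof
    show "infinite (B 0)"
      using card_of_ordIso_finite_Field[OF assms(1) ordIso_symmetric[OF B0]] assms(2) by simp
    show "|B n| \<le>o |R|" for n using B by (intro card_of_mono1) simp
    fix n
    have "is_beth \<nu> (Suc n) (\<gamma> (Suc n))" using \<gamma> by blast
    then obtain \<delta> :: "'b rel" where \<delta>: "is_beth \<nu> n \<delta>" "\<gamma> (Suc n) =o ctwo ^c \<delta>" by auto
    have "is_beth \<nu> n (\<gamma> n)" using \<gamma> by simp
    hence "\<gamma> n =o \<delta>" by (rule is_beth_unique[OF _ \<delta>(1)])
    moreover have "|B n| =o \<gamma> n" using B by simp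
    ultimately have "|B n| =o \<delta>" by (rule ordIso_transitive[rotated])
    hence "ctwo ^c |B n| =o ctwo ^c \<delta>" by (rule cexp_cong2[OF _ Card_order_ctwo card_of_Card_order])
    moreover have "|Pow (B n)| =o ctwo ^c |B n|"
      unfolding ctwo_def cexp_def Field_card_of by (rule card_of_Pow_Func)
    ultimately have "|Pow (B n)| =o ctwo ^c \<delta>" by (rule ordIso_transitive[rotated])
    also have "ctwo ^c \<delta> =o \<gamma> (Suc n)" by (rule ordIso_symmetric[OF \<delta>(2)])
    also have "\<gamma> (Suc n) =o |B (Suc n)|" by (rule ordIso_symmetric) (use B in simp)
    finally show "|Pow (B n)| \<le>o |B (Suc n)|" by (rule ordIso_imp_ordLeq)
  qed
  have suc: "Card_order (cardSuc \<rho>)" by (rule cardSuc_Card_order[OF assms(4)])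
  have rho_less: "\<rho> <o |A| \<longleftrightarrow> cardSuc \<rho> \<le>o |A|" for A :: "'x set"
    by (rule cardSuc_ordLess_ordLeq[OF assms(4) card_of_Card_order])
  \<comment> \<open>If more than \<rho> members contained \<open>S\<close>, then
    \<open>cardSuc \<rho>\<close> of them would have an intersection containing \<open>S\<close>,
    hence of size at least \<nu>.\<close>
  have "|{A\<in>\<F>. S \<subseteq> A}| \<le>o |R|" if S: "|B 0| \<le>o |S|" for S
  proof (rule ccontr)
    assume "\<not> ?thesis"
    hence "|R| <o |{A\<in>\<F>. S \<subseteq> A}|" by (simp add: not_card_of_ordLeq_iff)
    hence "\<rho> <o |{A\<in>\<F>. S \<subseteq> A}|" by (rule ordIso_ordLess_trans[OF ordIso_symmetric[OF R]])
    hence "cardSuc \<rho> \<le>o |{A\<in>\<F>. S \<subseteq> A}|" by (simp add: rho_less)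
    from Card_order_subset[OF suc this] obtain \<A> where
      \<A>: "\<A> \<subseteq> {A\<in>\<F>. S \<subseteq> A}" "|\<A>| =o cardSuc \<rho>" by (elim exE conjE)
    have "\<A> \<subseteq> \<F>" using \<A>(1) by blast
    hence "|\<Inter>\<A>| <o \<nu>" using assms(7) \<A>(2) by (simp add: C_condition_def)
    moreover have "S \<subseteq> \<Inter>\<A>" using \<A>(1) by blast
    hence "|S| \<le>o |\<Inter>\<A>|" by (rule card_of_mono1)
    hence "\<nu> \<le>o |\<Inter>\<A>|" by (rule ordIso_ordLeq_trans[OF ordIso_symmetric[OF B0] ordLeq_transitive[OF S]])
    ultimately show False using not_ordLess_ordLeq by blast
  qed
  moreover have "|A| =o |R|" if "A \<in> \<F>" for A
    by (rule ordIso_transitive[OF F_rho[OF that] ordIso_symmetric[OF R]])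
  ultimately have sparse: "sparse (\<Union>\<F>) \<F>" unfolding sparse_def by blast
  have "list_conflict_free TYPE('c) \<F> (cardSuc \<rho>)"
    unfolding list_conflict_free_def
  proof (intro allI impI)
    fix L :: "'a \<Rightarrow> 'c set" assume L: "\<forall>v\<in>\<Union>\<F>. cardSuc \<rho> \<le>o |L v|"
    have "|R| <o |L v|" if "v \<in> \<Union>\<F>" for v
      by (rule ordIso_ordLess_trans[OF R]) (use bspec[OF L that] in \<open>simp add: rho_less\<close>)
    \<comment> \<open>At the outset no color is forbidden.\<close>
    hence "colorable (\<Union>\<F>) \<F> L (\<lambda>_. {})"
      by (intro sparse_colorable[OF sparse]) (simp_all add: card_of_empty)
    thus "\<exists>c. conflict_free \<F> c \<and> (\<forall>v\<in>\<Union>\<F>. c v \<in> L v)"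
      unfolding colorable_def conflict_free_def by auto
  qed
  moreover have "{} \<notin> \<F>"
  proof
    assume "{} \<in> \<F>"
    from sparse_large[OF sparse this, of 0] show False
      using card_of_ordLeq_infinite infinite_B0 by blast
  qed
  ultimately show ?thesis using suc by (intro list_cf_number_least)
qed

end
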